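(* Let $d,m_u,p,N,n\ge 1$ be integers, $s=d+(N-1)p$, let $\mathbf A,\mathbf B,\mathbf E,Z$ be the matrices of the finite-horizon linear system described in the context, let $D\in\mathbb R^{N(d+m_u)\times N(d+m_u)}$ be symmetric positive semidefinite, and let $\hat w^1,\dots,\hat w^n\in\mathbb R^s$ be given noise-trajectory samples with empirical distribution $\hat{\mathbb P}_n=\frac1n\sum_{i=1}^n\delta_{\hat w^i}$. Take $\mathcal Z=\mathbb R^s$, transport cost $c(x,y)=\|x-y\|^2$, radius $\rho\ge 0$, regularization parameter $\epsilon>0$, and let the reference measure $\nu$ be the Gaussian distribution on $\mathbb R^s$ with mean $m\in\mathbb R^s$ and positive definite covariance $\Sigma\in\mathbb R^{s\times s}$. Let $\mathbb B_{\rho,\epsilon}(\hat{\mathbb P}_n)$ be the Sinkhorn ambiguity set (defined in the context). Consider the problem $$\min_{\mathbf\Phi\ \text{achievable}}\ \ \sup_{\mathbb P\in\mathbb B_{\rho,\epsilon}(\hat{\mathbb P}_n)}\ \mathbb E_{w\sim\mathbb P}\big[w^\top\mathbf\Phi^\top D\,\mathbf\Phi\, w\big].\qquad (\ast)$$ (1) Problem $(\ast)$ is feasible (i.e. $\mathbb B_{\rho,\epsilon}(\hat{\mathbb P}_n)\neq\emptyset$) if and only if $$\rho\ \ge\ \frac{\epsilon}{2}\log\Big|\Sigma+\frac{\epsilon}{2}I\Big|-\frac{\epsilon s}{2}\log\Big(\frac{\epsilon}{2}\Big)+\frac{\epsilon}{2}\,m^\top\Sigma^{-1}m+\frac1n\sum_{i=1}^n\Big[\|\hat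 w^i\|^2-\big(\hat w^i+\tfrac{\epsilon}{2}\Sigma^{-1}m\big)^\top\big(I+\tfrac{\epsilon}{2}\Sigma^{-1}\big)^{-1}\big(\hat w^i+\tfrac{\epsilon}{2}\Sigma^{-1}m\big)\Big].$$ (2) The optimal closed-loop map in $(\ast)$ is given by the minimizer of the following program; that is, if $(\lambda,Q,(s_i)_i,(\zeta_i)_i,\mathbf\Phi)$ is a minimizer of the program, then $\mathbf\Phi$ is a minimizer in $(\ast)$: $$\inf\ \ \lambda\rho+\frac1n\sum_{i=1}^n s_i$$ over $\lambda\in\mathbb R_+$, $Q\in\mathbb R^{s\times s}$ symmetric positive semidefinite, $s_i\in\mathbb R$, $\zeta_i\in\mathbb R$ ($i=1,\dots,n$) and $\mathbf\Phi\in\mathbb R^{N(d+m_u)\times s}$ achievable, subject to, for all $i=1,\dots,n$, $$M=\lambda\big(I+\tfrac{\epsilon}{2}\Sigma^{-1}\big)-Q,\qquad M\succ 0,$$ $$\frac{\lambda\epsilon s}{2}\log\Big(\frac{\lambda\epsilon}{2}\Big)-\frac{\lambda\epsilon}{2}\log|\Sigma|-\frac{\lambda\epsilon}{2}\log|M|+\zeta_i\ \le\ s_i,$$ $$\begin{bmatrix} M & \lambda\hat w^i+\frac{\lambda\epsilon}{2}\Sigma^{-1}m\\ \big(\lambda\hat w^i+\frac{\lambda\epsilon}{2}\Sigma^{-1}m\big)^\top & \zeta_i+\lambda\|\hat w^i\|^2+\frac{\lambda\epsilon}{2}m^\top\Sigma^{-1}m\end{bmatrix}\succeq 0,$$ $$\begin{bmatrix}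 Q & (D^{1/2}\mathbf\Phi)^\top\\ D^{1/2}\mathbf\Phi & I\end{bmatrix}\succeq 0 .$$
   Context: Notation: $|\cdot|$ of a square matrix is the determinant, $\|\cdot\|$ the Euclidean norm, $\succeq,\succ$ the Loewner order, $D^{1/2}$ the positive semidefinite square root. System: $x_{t+1}=A_tx_t+B_tu_t+E_tw_t$ with $A_t\in\mathbb R^{d\times d}$, $B_t\in\mathbb R^{d\times m_u}$, $E_t\in\mathbb R^{d\times p}$. Stacking $\boldsymbol x=(x_0,\dots,x_{N-1})$, $\boldsymbol u=(u_0,\dots,u_{N-1})$, $w=(x_0,w_0,\dots,w_{N-2})\in\mathbb R^s$, the dynamics read $\boldsymbol x=Z\mathbf A\boldsymbol x+Z\mathbf B\boldsymbol u+\mathbf E w$, where $Z\in\mathbb R^{Nd\times Nd}$ is the block downshift matrix ($d\times d$ identities on the first block subdiagonal, zero elsewhere), $\mathbf A=\mathrm{blkdiag}(A_0,\dots,A_{N-2},0_{d\times d})$, $\mathbf B=\mathrm{blkdiag}(B_0,\dots,B_{N-2},0_{d\times m_u})$, $\mathbf E=\mathrm{blkdiag}(I_{d},E_0,\dots,E_{N-2})$. Achievable maps: $\mathbf\Phi=\begin{bmatrix}\mathbf\Phi_x\\ \mathbf\Phi_u\end{bmatrix}$ with $\mathbf\Phi_x\in\mathbb R^{Nd\times s}$, $\mathbf\Phi_u\in\mathbb R^{Nm_u\times s}$ is achievable if $\mathbf\Phi_x,\mathbf\Phi_u$ are block lower triangular (row blocks indexed by time $0,\dots,N-1$; column blocks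 conformal with the partition $(x_0,w_0,\dots,w_{N-2})$ of $w$) and $\begin{bmatrix} I-Z\mathbf A & -Z\mathbf B\end{bmatrix}\begin{bmatrix}\mathbf\Phi_x\\ \mathbf\Phi_u\end{bmatrix}=\mathbf E$. These are the closed-loop maps $\boldsymbol x=\mathbf\Phi_xw$, $\boldsymbol u=\mathbf\Phi_uw$ induced by causal linear feedback, and the quadratic control cost $[\boldsymbol x^\top\ \boldsymbol u^\top]D[\boldsymbol x^\top\ \boldsymbol u^\top]^\top$ equals $w^\top\mathbf\Phi^\top D\mathbf\Phi w$. Sinkhorn discrepancy: for probability measures $\mathbb P,\mathbb Q$ on $\mathcal Z$, with reference measures $\mathbb P$ (first marginal) and $\nu$ (second marginal), $W_c^\epsilon(\mathbb P,\mathbb Q)=\inf_{\gamma\in\Gamma(\mathbb P,\mathbb Q)}\{\mathbb E_{(x,y)\sim\gamma}[c(x,y)]+\epsilon H(\gamma|\mathbb P\times\nu)\}$, where $\Gamma(\mathbb P,\mathbb Q)$ is the set of couplings of $\mathbb P$ and $\mathbb Q$ and $H(\gamma|\mathbb P\times\nu)=\mathbb E_\gamma[\log\frac{d\gamma}{d(\mathbb P\times\nu)}]$ is the Kullback–Leibler divergence ($+\infty$ if $\gamma\not\ll\mathbb P\times\nu$). Sinkhorn ambiguity set: $\mathbb B_{\rho,\epsilon}(\mathbb P)=\{\mathbb Q\in\mathcal P(\mathcal Z): W_c^\epsilon(\mathbb P,\mathbb Q)\le\rho\}$, where $\mathcal P(\mathcal Z)$ is the set of probability distributions on $\mathcal Z$.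 *)

theory Defs
  imports "HOL-Probability.Probability"
begin

section \<open>Matrices\<close>

text \<open>As in HOL-Analysis, a value of type \<open>real^'c^'r\<close> is a matrix with rows indexed by
  \<open>'r\<close> and columns indexed by \<open>'c\<close>. Block matrices are indexed by sum types.\<close>

definition psd :: "real^'n^'n \<Rightarrow> bool" where
  "psd A \<longleftrightarrow> transpose A = A \<and> (\<forall>x. 0 \<le> x \<bullet> (A *v x))"

definition posdef :: "real^'n^'n \<Rightarrow> bool" where
  "posdef A \<longleftrightarrow> transpose A = A \<and> (\<forall>x. x \<noteq> 0 \<longrightarrow> 0 < x \<bullet> (A *v x))"

definition psd_sqrt :: "real^'n^'n \<Rightarrow> real^'n^'n" where
  "psd_sqrt A = (THE R. psd R \<and> R ** R = A)"

definition hcat :: "real^'a^'r \<Rightarrow> real^'b^'r \<Rightarrow> real^('a + 'b)^'r" where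
  "hcat X Y = (\<chi> i j. case j of Inl a \<Rightarrow> X $ i $ a | Inr b \<Rightarrow> Y $ i $ b)"

definition vcat :: "real^'c^'a \<Rightarrow> real^'c^'b \<Rightarrow> real^'c^('a + 'b)" where
  "vcat X Y = (\<chi> i. case i of Inl a \<Rightarrow> X $ a | Inr b \<Rightarrow> Y $ b)"


section \<open>Index types of the stacked system\<close>

text \<open>The horizon \<open>N \<ge> 1\<close> is the cardinality of a finite linearly ordered type \<open>'N\<close>, whose
  elements in increasing order stand for the times \<open>0, \<dots>, N - 1\<close>; \<open>pos\<close> returns the time.
  Stacked states and inputs are then indexed by \<open>'N \<times> 'd\<close> and \<open>'N \<times> 'm\<close>.\<close>

definition pos :: "'N::{finite,linorder} \<Rightarrow> nat" where
  "pos t = card {..<t}"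

lemma pos_strict_mono: "t < t' \<Longrightarrow> pos t < pos t'" for t t' :: "'N::{finite,linorder}"
  unfolding pos_def by (intro psubset_card_mono) auto

lemma bij_betw_pos: "bij_betw pos (UNIV :: 'N::{finite,linorder} set) {..<CARD('N)}"
proof -
  have inj: "inj (pos :: 'N \<Rightarrow> nat)"
    by (metis injI linorder_neqE order_less_irrefl pos_strict_mono)
  have "pos t < CARD('N)" for t :: 'N
    unfolding pos_def by (intro psubset_card_mono) auto
  then have "range (pos :: 'N \<Rightarrow> nat) \<subseteq> {..<CARD('N)}"
    by auto
  moreover have "card (range (pos :: 'N \<Rightarrow> nat)) = CARD('N)"
    using inj by (rule card_image)
  ultimately have "range (pos :: 'N \<Rightarrow> nat) = {..<CARD('N)}"
    by (intro card_subset_eq) auto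
  with inj show ?thesis
    by (simp add: bij_betw_def)
qed

text \<open>Coordinates of the noise trajectory \<open>w = (x\<^sub>0, w\<^sub>0, \<dots>, w\<^bsub>N-2\<^esub>)\<close>: \<open>Inl j\<close> is the
  \<open>j\<close>-th coordinate of \<open>x\<^sub>0\<close> and \<open>Inr (t, j)\<close>, for a time \<open>pos t \<ge> 1\<close>, is the \<open>j\<close>-th
  coordinate of \<open>w\<^bsub>pos t - 1\<^esub>\<close>. For \<open>N = 1\<close> only the coordinates of \<open>x\<^sub>0\<close> remain.\<close>

typedef (overloaded) ('d, 'p, 'N::"{finite,linorder}") noise_idx =
  "range Inl \<union> Inr ` ({t. 1 \<le> pos t} \<times> UNIV) :: ('d + 'N \<times> 'p) set"
  by auto

instance noise_idx :: (finite, finite, "{finite,linorder}") finite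
proof
  show "finite (UNIV :: ('a, 'b, 'c) noise_idx set)"
    by (metis finite finite_imageI type_definition.univ type_definition_noise_idx)
qed

lemma card_noise_idx:
  "CARD(('d::finite, 'p::finite, 'N::{finite,linorder}) noise_idx)
     = CARD('d) + (CARD('N) - 1) * CARD('p)"
proof -
  let ?T = "{t :: 'N. 1 \<le> pos t}"
  have b: "bij_betw pos (UNIV :: 'N set) {..<CARD('N)}"
    by (rule bij_betw_pos)
  then have "pos ` ?T = {1..<CARD('N)}"
    using bij_betw_imp_surj_on[OF b] by (auto simp: set_eq_iff image_iff) (metis lessThan_iff)
  moreover have "inj_on pos ?T"
    using bij_betw_imp_inj_on[OF b] by (rule inj_on_subset) simp
  ultimately have T: "card ?T = CARD('N) - 1"
    by (metis card_atLeastLessThan card_image)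
  have "CARD(('d, 'p, 'N) noise_idx)
      = card (range Inl \<union> Inr ` (?T \<times> UNIV) :: ('d + 'N \<times> 'p) set)"
    by (rule type_definition.card[OF type_definition_noise_idx])
  also have "\<dots> = card (range Inl :: ('d + 'N \<times> 'p) set)
      + card (Inr ` (?T \<times> UNIV) :: ('d + 'N \<times> 'p) set)"
    by (intro card_Un_disjoint) auto
  also have "\<dots> = CARD('d) + card (?T \<times> (UNIV :: 'p set))"
    by (simp add: card_image)
  finally show ?thesis
    by (simp only: card_cartesian_product T)
qed

definition noise_block :: "('d, 'p, 'N::{finite,linorder}) noise_idx \<Rightarrow> nat" where
  "noise_block k = (case Rep_noise_idx k of Inl _ \<Rightarrow> 0 | Inr (t, _) \<Rightarrow> pos t)"


section \<open>The stacked system and achievable closed-loop maps\<close>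

definition downshift :: "real^('N::{finite,linorder} \<times> 'd::finite)^('N \<times> 'd)" where
  "downshift = (\<chi> r c. if pos (fst r) = Suc (pos (fst c)) \<and> snd r = snd c then 1 else 0)"

text \<open>\<open>blkdiag(F\<^sub>0, \<dots>, F\<^bsub>N-2\<^esub>, 0)\<close>; only the values of \<open>F\<close> below \<open>N - 1\<close> are used.\<close>

definition blkdiag0 ::
    "(nat \<Rightarrow> real^'b::finite^'a::finite) \<Rightarrow>
     real^('N::{finite,linorder} \<times> 'b)^('N \<times> 'a)" where
  "blkdiag0 F = (\<chi> r c. if fst r = fst c \<and> Suc (pos (fst r)) < CARD('N)
                         then F (pos (fst r)) $ snd r $ snd c else 0)"

text \<open>\<open>blkdiag(I, E\<^sub>0, \<dots>, E\<^bsub>N-2\<^esub>)\<close>.\<close>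

definition noise_mat ::
    "(nat \<Rightarrow> real^'p::finite^'d::finite) \<Rightarrow>
     real^('d, 'p, 'N::{finite,linorder}) noise_idx^('N \<times> 'd)" where
  "noise_mat E = (\<chi> r c. case Rep_noise_idx c of
       Inl j \<Rightarrow> if pos (fst r) = 0 \<and> snd r = j then 1 else 0
     | Inr (t, j) \<Rightarrow> if fst r = t then E (pos t - 1) $ snd r $ j else 0)"

definition block_lower_triangular ::
    "real^('d::finite, 'p::finite, 'N::{finite,linorder}) noise_idx^('N \<times> 'a::finite) \<Rightarrow> bool" where
  "block_lower_triangular X \<longleftrightarrow> (\<forall>r c. pos (fst r) < noise_block c \<longrightarrow> X $ r $ c = 0)"

definition achievable ::
    "(nat \<Rightarrow> real^'d::finite^'d) \<Rightarrow> (nat \<Rightarrow> real^'m::finite^'d) \<Rightarrow> (nat \<Rightarrow> real^'p::finite^'d) \<Rightarrow>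
     real^('d, 'p, 'N::{finite,linorder}) noise_idx^('N \<times> 'd + 'N \<times> 'm) \<Rightarrow> bool" where
  "achievable A B E \<Phi> \<longleftrightarrow>
     (\<exists>\<Phi>x \<Phi>u. \<Phi> = vcat \<Phi>x \<Phi>u \<and> block_lower_triangular \<Phi>x \<and> block_lower_triangular \<Phi>u) \<and>
     hcat (mat 1 - downshift ** blkdiag0 A) (- (downshift ** blkdiag0 B)) ** \<Phi> = noise_mat E"


section \<open>Sinkhorn discrepancy and ambiguity set\<close>

definition couplings :: "'a measure \<Rightarrow> 'b measure \<Rightarrow> ('a \<times> 'b) measure set" where
  "couplings P Q = {\<gamma>. prob_space \<gamma> \<and> sets \<gamma> = sets (P \<Otimes>\<^sub>M Q) \<and>
                       distr \<gamma> P fst = P \<and> distr \<gamma> Q snd = Q}"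

text \<open>\<open>H(\<gamma> | \<mu>)\<close> for probability measures. \<open>KL_divergence\<close> is a Bochner integral, which is \<open>0\<close>
  by convention when the log-density is not \<open>\<gamma>\<close>-integrable. The negative part of the
  log-density always has finite integral, so in that case the true value is \<open>\<infinity>\<close>.\<close>

definition rel_entropy :: "'a measure \<Rightarrow> 'a measure \<Rightarrow> ereal" where
  "rel_entropy \<gamma> \<mu> =
     (if absolutely_continuous \<mu> \<gamma> \<and> integrable \<gamma> (entropy_density (exp 1) \<mu> \<gamma>)
      then ereal (KL_divergence (exp 1) \<mu> \<gamma>) else \<infinity>)"

definition sinkhorn ::
    "('a \<Rightarrow> 'a \<Rightarrow> ennreal) \<Rightarrow> real \<Rightarrow> 'a measure \<Rightarrow> 'a measure \<Rightarrow> 'a measure \<Rightarrow> ereal" where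
  "sinkhorn c \<epsilon> \<nu> P Q =
     (INF \<gamma>\<in>couplings P Q.
        enn2ereal (\<integral>\<^sup>+ z. c (fst z) (snd z) \<partial>\<gamma>) + ereal \<epsilon> * rel_entropy \<gamma> (P \<Otimes>\<^sub>M \<nu>))"

definition sinkhorn_ball ::
    "('a::topological_space \<Rightarrow> 'a \<Rightarrow> ennreal) \<Rightarrow> real \<Rightarrow> 'a measure \<Rightarrow> real \<Rightarrow>
     'a measure \<Rightarrow> 'a measure set" where
  "sinkhorn_ball c \<epsilon> \<nu> \<rho> P =
     {Q. prob_space Q \<and> sets Q = sets borel \<and> sinkhorn c \<epsilon> \<nu> P Q \<le> ereal \<rho>}"

definition sq_dist :: "real^'k \<Rightarrow> real^'k \<Rightarrow> ennreal" where
  "sq_dist x y = ennreal ((norm (x - y))\<^sup>2)"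

definition gaussian :: "real^'k \<Rightarrow> real^'k^'k \<Rightarrow> (real^'k) measure" where
  "gaussian m \<Sigma> = density lborel (\<lambda>y. ennreal
     (exp (- ((y - m) \<bullet> (matrix_inv \<Sigma> *v (y - m))) / 2) / sqrt ((2 * pi) ^ CARD('k) * det \<Sigma>)))"

definition empirical :: "nat \<Rightarrow> (nat \<Rightarrow> 'a::topological_space) \<Rightarrow> 'a measure" where
  "empirical n w = distr (uniform_count_measure {1..n}) borel w"

lemma emeasure_empirical:
  assumes "1 \<le> n" and "X \<in> sets borel"
  shows "emeasure (empirical n w) X = ennreal (1 / real n * (\<Sum>i=1..n. indicator X (w i)))"
proof -
  have "emeasure (empirical n w) X = emeasure (uniform_count_measure {1..n}) (w -` X \<inter> {1..n})"
    unfolding empirical_def using assms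
    by (subst emeasure_distr)
       (auto simp: uniform_count_measure_def measurable_def space_point_measure sets_point_measure)
  also have "\<dots> = ennreal (card (w -` X \<inter> {1..n}) / n)"
    by (subst emeasure_uniform_count_measure) (auto simp: ennreal_divide_numeral)
  also have "real (card (w -` X \<inter> {1..n})) = (\<Sum>i=1..n. indicator X (w i))"
    by (simp add: indicator_def sum.If_cases Int_def conj_commute)
  finally show ?thesis by simp
qed


section \<open>The distributionally robust problem and its reformulation\<close>

text \<open>The supremum over an empty ambiguity set is \<open>-\<infinity>\<close>. The integrand
  \<open>w\<^sup>T \<Phi>\<^sup>T D \<Phi> w\<close> is nonnegative for positive semidefinite \<open>D\<close>, so \<open>ennreal\<close> truncates nothing.\<close>

definition worst_case_cost ::
    "(real^'k) measure set \<Rightarrow> real^'q^'q \<Rightarrow> real^'k^'q \<Rightarrow> ereal" where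
  "worst_case_cost \<B> D \<Phi> =
     (SUP P\<in>\<B>. enn2ereal (\<integral>\<^sup>+ w. ennreal (w \<bullet> ((transpose \<Phi> ** D ** \<Phi>) *v w)) \<partial>P))"

text \<open>The constraints of the convex program, apart from achievability of \<open>\<Phi>\<close>;
  \<open>\<sigma> i\<close> is the epigraph variable \<open>s\<^sub>i\<close>.\<close>

definition program_constraints ::
    "real \<Rightarrow> real^'k \<Rightarrow> real^'k^'k \<Rightarrow> nat \<Rightarrow> (nat \<Rightarrow> real^'k) \<Rightarrow> real^'q^'q \<Rightarrow>
     real \<Rightarrow> real^'k^'k \<Rightarrow> (nat \<Rightarrow> real) \<Rightarrow> (nat \<Rightarrow> real) \<Rightarrow> real^'k^'q \<Rightarrow> bool" where
  "program_constraints \<epsilon> m \<Sigma> n w D l Q \<sigma> \<zeta> \<Phi> \<longleftrightarrow>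
     (let s = real CARD('k);
          M = l *\<^sub>R (mat 1 + (\<epsilon> / 2) *\<^sub>R matrix_inv \<Sigma>) - Q
      in 0 \<le> l \<and> psd Q \<and> posdef M \<and>
         (\<forall>i\<in>{1..n}.
            l * \<epsilon> * s / 2 * ln (l * \<epsilon> / 2) - l * \<epsilon> / 2 * ln (det \<Sigma>)
              - l * \<epsilon> / 2 * ln (det M) + \<zeta> i \<le> \<sigma> i) \<and>
         (\<forall>i\<in>{1..n}.
            let b = l *\<^sub>R w i + (l * \<epsilon> / 2) *\<^sub>R (matrix_inv \<Sigma> *v m);
                h = \<zeta> i + l * (norm (w i))\<^sup>2 + l * \<epsilon> / 2 * (m \<bullet> (matrix_inv \<Sigma> *v m))
            in psd (vcat (hcat M (columnvector b :: real^1^'k))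
                         (hcat (rowvector b) (mat h :: real^1^1)))) \<and>
         psd (vcat (hcat Q (transpose (psd_sqrt D ** \<Phi>)))
                   (hcat (psd_sqrt D ** \<Phi>) (mat 1))))"

end

theory Submission
  imports Defs
begin

text \<open>For a symmetric \<open>X\<close> with \<open>K - X\<close> positive definite, where \<open>K = I + (\<epsilon>/2) \<Sigma>\<inverse>\<close>, let
  \<open>G(X)\<close> be the average over the samples of the soft maximum
  \<open>\<epsilon> ln \<integral> exp ((y\<^sup>T X y - \<parallel>w\<^sup>i - y\<parallel>\<^sup>2) / \<epsilon>) d\<nu>(y)\<close>, a Gaussian integral. The Gibbs variational
  principle gives \<open>E\<^sub>Q[y\<^sup>T X y] \<le> \<rho> + G(X)\<close> for every \<open>Q\<close> in the ambiguity set of radius \<open>\<rho>\<close>, and the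
  second marginal of the Gibbs measure of \<open>X\<close> attains equality at its own radius. At \<open>X = 0\<close> this is
  the feasibility threshold \<open>-G(0)\<close>. At \<open>X = Q / \<lambda>\<close> it says that the program bounds the worst-case
  cost from above.

  Conversely, for the cost matrix \<open>C\<close> of a closed-loop map, weak duality makes the affine function
  \<open>t \<mapsto> t E[y\<^sup>T C y] - (radius)\<close> of a Gibbs measure a tangent to \<open>t \<mapsto> G(t C)\<close>, so the derivative of the
  latter is the expected cost. The dual objective is \<open>(\<rho> + G(t C)) / t\<close> with \<open>t = 1 / \<lambda>\<close>. If \<open>\<rho>\<close> exceeds
  the threshold and \<open>C \<noteq> 0\<close>, it blows up at both ends of its domain, and at an interior minimum
  stationarity says that the Gibbs measure lies in the ambiguity set with cost equal to the dual
  value. If \<open>\<rho>\<close> equals the threshold, the objective is a difference quotient that tends to the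
  expected cost of the Gibbs measure of \<open>0\<close>. So there is no duality gap, whether or not the dual
  infimum is attained.\<close>

section \<open>Symmetric matrices and the positive semidefinite square root\<close>

lemma inner_transpose:
  fixes A :: "real^'n^'m"
  shows "x \<bullet> (A *v y) = (transpose A *v x) \<bullet> y"
  by (metis dot_lmul_matrix transpose_matrix_vector)

lemma symmetric_inner_commute:
  fixes A :: "real^'n^'n"
  assumes "transpose A = A"
  shows "x \<bullet> (A *v y) = y \<bullet> (A *v x)"
  by (metis assms inner_commute inner_transpose)

lemma matrix_eqI_vector:
  fixes A B :: "real^'n^'m"
  assumes "\<And>x. A *v x = B *v x"
  shows "A = B"
  using assms matrix_eq by blast

lemma transpose_add: "transpose (A + B) = transpose A + transpose (B :: real^'n^'m)"
  by (simp add: transpose_def vec_eq_iff)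

lemma transpose_diff: "transpose (A - B) = transpose A - transpose (B :: real^'n^'m)"
  by (simp add: transpose_def vec_eq_iff)

lemma transpose_scaleR: "transpose (c *\<^sub>R A) = c *\<^sub>R transpose (A :: real^'n^'m)"
  by (simp add: transpose_def vec_eq_iff)

lemma symmetricI:
  fixes A :: "real^'n^'n"
  assumes "\<And>x y. x \<bullet> (A *v y) = (A *v x) \<bullet> y"
  shows "transpose A = A"
proof (rule matrix_eqI_vector)
  fix x
  have "(transpose A *v x) \<bullet> y = (A *v x) \<bullet> y" for y
    using assms by (metis inner_transpose)
  then show "transpose A *v x = A *v x"
    using vector_eq_rdot by blast
qed

lemma continuous_on_quadratic:
  fixes A :: "real^'n^'n"
  shows "continuous_on S (\<lambda>x. x \<bullet> (A *v x))"
  by (intro continuous_intros linear_continuous_on_compose[OF continuous_on_id]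
        matrix_vector_mul_linear)

lemma posdef_imp_psd: "posdef A \<Longrightarrow> psd A"
  unfolding posdef_def psd_def
  by (metis inner_zero_left order_le_less)

text \<open>A form that is nonnegative on \<open>S\<close> and vanishes at \<open>v\<close> is
  minimal there, so its gradient \<open>2 *\<^sub>R (A *v v)\<close> must vanish: a short step
  against it would make the form negative. The subspace \<open>S\<close> lets this act as a Lagrange
  condition in \<open>symmetric_eigenvector\<close>.\<close>

lemma psd_null_vector:
  fixes A :: "real^'n^'n"
  assumes sym: "transpose A = A" and S: "subspace S" "v \<in> S" "A *v v \<in> S"
    and nonneg: "\<And>x. x \<in> S \<Longrightarrow> 0 \<le> x \<bullet> (A *v x)" and zero: "v \<bullet> (A *v v) = 0"
  shows "A *v v = 0"
proof (rule ccontr)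
  define w where "w = A *v v"
  assume "A *v v \<noteq> 0"
  then have w: "w \<bullet> w > 0" by (simp add: w_def)
  define q where "q = w \<bullet> (A *v w)"
  have "w \<in> S" using S by (simp add: w_def)
  then have q: "0 \<le> q" unfolding q_def by (rule nonneg)
  \<comment> \<open>Along \<open>v + t *\<^sub>R w\<close> the form is
    \<open>2 * t * (w \<bullet> w) + t * t * q\<close>, negative for small negative
    \<open>t\<close>. The summand 1 in the denominator covers \<open>q = 0\<close>.\<close>
  define t where "t = - (w \<bullet> w) / (q + 1)"
  have mem: "v + t *\<^sub>R w \<in> S"
    using S \<open>w \<in> S\<close> by (simp add: subspace_add subspace_scale)
  have "(v + t *\<^sub>R w) \<bullet> (A *v (v + t *\<^sub>R w))
      = v \<bullet> (A *v v) + t * (v \<bullet> (A *v w)) + t * (w \<bullet> (A *v v)) + t * t * q"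
    by (simp add: q_def matrix_vector_right_distrib matrix_vector_mult_scaleR
        inner_add_left inner_add_right algebra_simps)
  also have "\<dots> = 2 * t * (w \<bullet> w) + t * t * q"
    using zero symmetric_inner_commute[OF sym, of v w] by (simp add: w_def)
  also have "\<dots> = t * (w \<bullet> w) * (2 - q / (q + 1))"
  proof -
    have "t * q = - (w \<bullet> w) * (q / (q + 1))" by (simp add: t_def)
    then have "t * t * q = t * (- (w \<bullet> w) * (q / (q + 1)))" by (simp only: mult.assoc)
    then show ?thesis by (simp add: algebra_simps)
  qed
  also have "\<dots> < 0"
  proof (rule mult_neg_pos)
    show "t * (w \<bullet> w) < 0" using w q
      by (intro mult_neg_pos) (auto simp: t_def field_simps)
    show "0 < 2 - q / (q + 1)" using q by (simp add: field_simps)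
  qed
  finally show False using nonneg[OF mem] by simp
qed

text \<open>Rayleigh quotient: let the form be maximal at \<open>v\<close> on the unit sphere of
  \<open>S\<close>, with value \<mu>. Then \<open>\<mu> *\<^sub>R mat 1 - A\<close> is nonnegative
  on \<open>S\<close> and its form vanishes at \<open>v\<close>, so it annihilates
  \<open>v\<close>.\<close>

lemma symmetric_eigenvector:
  fixes A :: "real^'n^'n"
  assumes sym: "transpose A = A" and S: "subspace S" "S \<noteq> {0}"
    and inv: "\<And>x. x \<in> S \<Longrightarrow> A *v x \<in> S"
  obtains v \<mu> where "v \<in> S" "norm v = 1" "A *v v = \<mu> *\<^sub>R v"
proof -
  let ?C = "S \<inter> sphere 0 1"
  obtain u where u: "u \<in> S" "u \<noteq> 0" using S subspace_0 by fastforce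
  have "(1 / norm u) *\<^sub>R u \<in> ?C" using u S by (auto simp: subspace_scale)
  then have ne: "?C \<noteq> {}" by blast
  have "compact ?C"
    by (simp add: S closed_Int_compact closed_subspace)
  from continuous_attains_sup[OF this ne continuous_on_quadratic[of _ A]]
  obtain v where v: "v \<in> S" "norm v = 1"
    and max: "\<And>x. x \<in> S \<Longrightarrow> norm x = 1 \<Longrightarrow> x \<bullet> (A *v x) \<le> v \<bullet> (A *v v)"
    by auto
  define \<mu> where "\<mu> = v \<bullet> (A *v v)"
  let ?T = "\<mu> *\<^sub>R mat 1 - A"
  have T: "?T *v x = \<mu> *\<^sub>R x - A *v x" for x
    by (simp add: matrix_vector_mult_diff_rdistrib flip: scaleR_matrix_vector_assoc)
  have "?T *v v = 0"
  proof (rule psd_null_vector[OF _ \<open>subspace S\<close> \<open>v \<in> S\<close>])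
    show "transpose ?T = ?T" by (simp add: transpose_diff transpose_scaleR sym)
    show "?T *v v \<in> S" unfolding T using v inv S by (simp add: subspace_diff subspace_scale)
    show "v \<bullet> (?T *v v) = 0" unfolding T using v
      by (simp add: inner_diff_right \<mu>_def norm_eq_1)
    fix x assume x: "x \<in> S"
    show "0 \<le> x \<bullet> (?T *v x)"
    proof (cases "x = 0")
      case False
      define y where "y = (1 / norm x) *\<^sub>R x"
      have "y \<bullet> (A *v y) \<le> \<mu>"
        unfolding \<mu>_def by (rule max) (use False x S in \<open>auto simp: y_def subspace_scale\<close>)
      moreover have "y \<bullet> (A *v y) = (x \<bullet> (A *v x)) / (norm x)\<^sup>2"
        by (simp add: y_def matrix_vector_mult_scaleR power2_eq_square)
      ultimately show ?thesis using False
        by (simp add: T inner_diff_right power2_norm_eq_inner field_simps)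
    qed auto
  qed
  then show thesis using that[of v \<mu>] v T by simp
qed

text \<open>Take an orthonormal set of eigenvectors of maximal cardinality. If it did not span, its
  orthogonal complement, invariant under \<open>A\<close> by symmetry, would contain one more unit
  eigenvector.\<close>

lemma spectral_basis:
  fixes A :: "real^'n^'n"
  assumes sym: "transpose A = A"
  obtains V \<mu> where "finite V" "pairwise orthogonal V" "\<And>v. v \<in> V \<Longrightarrow> norm v = 1" "span V = UNIV"
    "\<And>v. v \<in> V \<Longrightarrow> A *v v = \<mu> v *\<^sub>R v"
proof -
  define P where "P V \<longleftrightarrow> pairwise orthogonal V \<and> (\<forall>v\<in>V. norm v = 1) \<and> (\<forall>v\<in>V. \<exists>\<mu>. A *v v = \<mu> *\<^sub>R v)"
    for V :: "(real^'n) set"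
  have indep: "independent V" if "P V" for V
    using that by (intro pairwise_orthogonal_independent) (auto simp: P_def)
  have bound: "card V \<le> DIM(real^'n)" if "P V" for V
    using independent_bound[OF indep[OF that]] by simp
  have "P {}" by (auto simp: P_def pairwise_def)
  then obtain V where V: "P V" and max: "\<And>W. P W \<Longrightarrow> card W \<le> card V"
    using ex_has_greatest_nat[of P "{}" card "Suc (DIM(real^'n))"] bound
    by (metis le_imp_less_Suc)
  have fin: "finite V" using independent_bound[OF indep[OF V]] by simp
  have "span V = UNIV"
  proof (rule ccontr)
    assume "span V \<noteq> UNIV"
    define S where "S = {x. \<forall>v\<in>V. orthogonal v x}"
    have "subspace S" unfolding S_def
      by (auto simp: subspace_def orthogonal_def inner_add_right)
    moreover have "S \<noteq> {0}"
    proof -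
      obtain a where "a \<noteq> 0" "\<And>x. x \<in> span V \<Longrightarrow> orthogonal a x"
        using span_not_UNIV_orthogonal[OF \<open>span V \<noteq> UNIV\<close>] by (auto simp: orthogonal_def)
      then have "a \<in> S" by (auto simp: S_def orthogonal_commute span_base)
      then show ?thesis using \<open>a \<noteq> 0\<close> by auto
    qed
    moreover have "A *v x \<in> S" if "x \<in> S" for x
      unfolding S_def
    proof safe
      fix v assume v: "v \<in> V"
      then obtain \<mu> where "A *v v = \<mu> *\<^sub>R v" using V by (auto simp: P_def)
      then have "v \<bullet> (A *v x) = \<mu> * (x \<bullet> v)"
        by (simp add: symmetric_inner_commute[OF sym, of v x])
      then show "orthogonal v (A *v x)" using that v
        by (auto simp: S_def orthogonal_def inner_commute)
    qed
    ultimately obtain u \<mu> where u: "u \<in> S" "norm u = 1" "A *v u = \<mu> *\<^sub>R u"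
      using symmetric_eigenvector[OF sym] by metis
    have "u \<notin> V" using u by (auto simp: S_def orthogonal_def norm_eq_1)
    have "P (insert u V)"
      using V u by (auto simp: P_def S_def pairwise_insert orthogonal_commute)
    from max[OF this] show False using \<open>u \<notin> V\<close> fin by simp
  qed
  moreover obtain \<mu> where "\<And>v. v \<in> V \<Longrightarrow> A *v v = \<mu> v *\<^sub>R v"
    using V unfolding P_def by metis
  ultimately show thesis using that[of V \<mu>] V fin by (auto simp: P_def)
qed

lemma matrix_zero_on_spanning:
  fixes A :: "real^'n^'m"
  assumes "span V = UNIV" "\<And>v. v \<in> V \<Longrightarrow> A *v v = B *v v"
  shows "A = B"
  using linear_eq_on_span[OF matrix_vector_mul_linear matrix_vector_mul_linear, of V A B] assms
  by (intro matrix_eqI_vector) auto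

section \<open>Existence and uniqueness of the positive semidefinite square root\<close>

lemma psd_sqrt_exists:
  fixes A :: "real^'n^'n"
  assumes "psd A"
  shows "\<exists>R. psd R \<and> R ** R = A"
proof -
  have sym: "transpose A = A" using assms by (simp add: psd_def)
  obtain V \<mu> where V: "finite V" "pairwise orthogonal V" "\<And>v. v \<in> V \<Longrightarrow> norm v = 1"
    "span V = UNIV" and eig: "\<And>v. v \<in> V \<Longrightarrow> A *v v = \<mu> v *\<^sub>R v"
    using spectral_basis[OF sym] by metis
  have \<mu>: "0 \<le> \<mu> v" if "v \<in> V" for v
  proof -
    have "0 \<le> v \<bullet> (A *v v)" using assms by (simp add: psd_def)
    then show ?thesis using eig[OF that] V(3)[OF that] by (simp add: norm_eq_1)
  qed
  \<comment> \<open>The map that scales each eigenvector by the root of its eigenvalue, written with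
    coordinates \<open>v \<bullet> x\<close> in the orthonormal basis.\<close>
  define f where "f x = (\<Sum>v\<in>V. (sqrt (\<mu> v) * (v \<bullet> x)) *\<^sub>R v)" for x
  have lin: "linear f"
    unfolding f_def
    by (rule linearI) (simp_all add: inner_add_right algebra_simps sum.distrib scaleR_sum_right)
  define R where "R = matrix f"
  have R: "R *v x = f x" for x
    using matrix_vector_mul(2)[OF lin] unfolding R_def by metis
  have fv: "f v = sqrt (\<mu> v) *\<^sub>R v" if "v \<in> V" for v
  proof -
    have "f v = (\<Sum>u\<in>V. if u = v then sqrt (\<mu> v) *\<^sub>R v else 0)"
      unfolding f_def using V(2,3) that
      by (intro sum.cong) (auto simp: pairwise_def orthogonal_def norm_eq_1)
    then show ?thesis using V(1) that by simp
  qed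
  have "R ** R = A"
  proof (rule matrix_zero_on_spanning[OF V(4)])
    fix v assume v: "v \<in> V"
    show "(R ** R) *v v = A *v v"
      using v \<mu>[OF v]
      by (simp add: R fv eig linear_scale[OF lin] flip: matrix_vector_mul_assoc)
  qed
  moreover have "psd R"
    unfolding psd_def
  proof safe
    show "transpose R = R"
      by (rule symmetricI)
        (simp add: R f_def inner_sum_left inner_sum_right inner_commute algebra_simps)
    show "0 \<le> x \<bullet> (R *v x)" for x
      by (auto simp: R f_def inner_sum_right inner_commute \<mu> mult.assoc intro!: sum_nonneg)
  qed
  ultimately show ?thesis by blast
qed

text \<open>Let \<open>v\<close> be an eigenvector of \<open>R - S\<close> with eigenvalue \<mu>.
  Equal squares give \<open>R *v v\<close> and \<open>S *v v\<close> the same norm, that is, \<mu>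
  times the sum of \<open>v \<bullet> (R *v v)\<close> and \<open>v \<bullet> (S *v v)\<close> is 0.
  If the sum is 0, both nonnegative terms vanish, and so does their difference
  \<open>\<mu> v * (v \<bullet> v)\<close>.\<close>

lemma psd_sqrt_unique:
  fixes R S :: "real^'n^'n"
  assumes "psd R" "psd S" "R ** R = S ** S"
  shows "R = S"
proof -
  let ?T = "R - S"
  have sR: "transpose R = R" and sS: "transpose S = S" using assms by (auto simp: psd_def)
  have "transpose ?T = ?T" by (simp add: transpose_diff sR sS)
  then obtain V \<mu> where V: "span V = UNIV" and eig: "\<And>v. v \<in> V \<Longrightarrow> ?T *v v = \<mu> v *\<^sub>R v"
    using spectral_basis by metis
  show ?thesis
  proof (rule matrix_zero_on_spanning[OF V])
    fix v assume v: "v \<in> V"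
    have T: "R *v v = S *v v + \<mu> v *\<^sub>R v"
      using eig[OF v] by (simp add: matrix_vector_mult_diff_rdistrib algebra_simps)
    have "(R *v v) \<bullet> (R *v v) = v \<bullet> ((R ** R) *v v)"
      by (simp add: inner_transpose[of v R] sR flip: matrix_vector_mul_assoc)
    also have "\<dots> = (S *v v) \<bullet> (S *v v)"
      by (simp add: assms(3) inner_transpose[of v S] sS flip: matrix_vector_mul_assoc)
    finally have "(S *v v + \<mu> v *\<^sub>R v) \<bullet> (S *v v + \<mu> v *\<^sub>R v) = (S *v v) \<bullet> (S *v v)"
      by (simp add: T)
    then have "\<mu> v * (2 * (v \<bullet> (S *v v)) + \<mu> v * (v \<bullet> v)) = 0"
      by (simp add: inner_add_left inner_add_right inner_commute algebra_simps)
    then consider "\<mu> v = 0" | "2 * (v \<bullet> (S *v v)) + \<mu> v * (v \<bullet> v) = 0" by auto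
    then have "\<mu> v *\<^sub>R v = 0"
    proof cases
      case 2
      have "0 \<le> v \<bullet> (R *v v)" "0 \<le> v \<bullet> (S *v v)" using assms by (auto simp: psd_def)
      then have "\<mu> v * (v \<bullet> v) = 0" using 2 unfolding T inner_add_right by (simp only: inner_scaleR_right)
      then show ?thesis by auto
    qed simp
    then show "R *v v = S *v v" using T by simp
  qed
qed

lemma psd_sqrt:
  fixes A :: "real^'n^'n"
  assumes "psd A"
  shows "psd (psd_sqrt A)" "psd_sqrt A ** psd_sqrt A = A"
proof -
  have "\<exists>!R. psd R \<and> R ** R = A"
    using psd_sqrt_exists[OF assms] psd_sqrt_unique by metis
  from theI'[OF this] show "psd (psd_sqrt A)" "psd_sqrt A ** psd_sqrt A = A"
    by (auto simp: psd_sqrt_def)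
qed

section \<open>Linear change of variables for Lebesgue measure\<close>

text \<open>The library states the linear change of variables only for well-ordered index types, which
  the index type of the noise trajectories is not.\<close>

lemma nn_integral_lborel_split_coord:
  fixes h :: "'a::euclidean_space \<Rightarrow> ennreal"
  assumes [measurable]: "h \<in> borel_measurable borel" and e: "e \<in> Basis"
  shows "(\<integral>\<^sup>+ x. h x \<partial>lborel) =
    (\<integral>\<^sup>+ x. (\<integral>\<^sup>+ y. h (y *\<^sub>R e + (\<Sum>b\<in>Basis - {e}. x b *\<^sub>R b)) \<partial>lborel)
      \<partial>(\<Pi>\<^sub>M b\<in>Basis - {e}. lborel))"
proof -
  interpret product_sigma_finite "\<lambda>b::'a. lborel :: real measure"
    by (rule product_sigma_finite.intro) (rule sigma_finite_lborel)
  have ins: "insert e (Basis - {e}) = Basis" using e by auto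
  have "(\<integral>\<^sup>+ x. h x \<partial>lborel) = (\<integral>\<^sup>+ x. h (\<Sum>b\<in>Basis. x b *\<^sub>R b) \<partial>(\<Pi>\<^sub>M b\<in>Basis. lborel))"
    by (subst lborel_eq) (simp add: nn_integral_distr)
  also have "\<dots> = (\<integral>\<^sup>+ x. h (\<Sum>b\<in>insert e (Basis - {e}). x b *\<^sub>R b)
      \<partial>(\<Pi>\<^sub>M b\<in>insert e (Basis - {e}). lborel))"
    by (simp only: ins)
  also have "\<dots> = (\<integral>\<^sup>+ x. (\<integral>\<^sup>+ y. h (\<Sum>b\<in>insert e (Basis - {e}). (x(e := y)) b *\<^sub>R b) \<partial>lborel)
      \<partial>(\<Pi>\<^sub>M b\<in>Basis - {e}. lborel))"
    by (rule product_nn_integral_insert) auto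
  also have "\<dots> = (\<integral>\<^sup>+ x. (\<integral>\<^sup>+ y. h (y *\<^sub>R e + (\<Sum>b\<in>Basis - {e}. x b *\<^sub>R b)) \<partial>lborel)
      \<partial>(\<Pi>\<^sub>M b\<in>Basis - {e}. lborel))"
    by (intro nn_integral_cong arg_cong[of _ _ h]) (subst sum.insert, auto intro!: sum.cong)
  finally show ?thesis .
qed

text \<open>On a line parallel to \<open>e\<close> the coordinate \<open>x \<bullet> n\<close> is
  constant, so the shear acts there as a translation.\<close>

lemma nn_integral_lborel_shear:
  fixes h :: "'a::euclidean_space \<Rightarrow> ennreal"
  assumes [measurable]: "h \<in> borel_measurable borel" and e: "e \<in> Basis" "n \<in> Basis" "e \<noteq> n"
  shows "(\<integral>\<^sup>+ x. h (x + (x \<bullet> n) *\<^sub>R e) \<partial>lborel) = (\<integral>\<^sup>+ x. h x \<partial>lborel)"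
proof -
  have "(\<integral>\<^sup>+ y. h (y *\<^sub>R e + v + ((y *\<^sub>R e + v) \<bullet> n) *\<^sub>R e) \<partial>lborel)
      = (\<integral>\<^sup>+ y. h (y *\<^sub>R e + v) \<partial>lborel)" for v
  proof -
    have "(\<integral>\<^sup>+ y. h (y *\<^sub>R e + v) \<partial>lborel)
        = ennreal \<bar>1\<bar> * (\<integral>\<^sup>+ y. h ((v \<bullet> n + 1 * y) *\<^sub>R e + v) \<partial>lborel)"
      by (rule nn_integral_real_affine) auto
    also have "\<dots> = (\<integral>\<^sup>+ y. h (y *\<^sub>R e + v + ((y *\<^sub>R e + v) \<bullet> n) *\<^sub>R e) \<partial>lborel)"
      using e by (simp add: inner_add_left inner_Basis algebra_simps)
    finally show ?thesis by simp
  qed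
  then show ?thesis
    by (subst (2) nn_integral_lborel_split_coord[OF _ e(1)], measurable, subst nn_integral_lborel_split_coord[OF _ e(1)], measurable)
qed

lemma borel_measurable_linear:
  fixes f :: "'a::euclidean_space \<Rightarrow> 'b::euclidean_space"
  assumes "linear f"
  shows "f \<in> borel_measurable borel"
  using assms linear_continuous_on linear_conv_bounded_linear
  by (intro borel_measurable_continuous_onI) auto

text \<open>Permuting coordinates sends boxes to boxes with the same side lengths up to order, and
  Lebesgue measure is determined by its values on boxes.\<close>

lemma nn_integral_lborel_permute:
  fixes h :: "real^'n \<Rightarrow> ennreal"
  assumes [measurable]: "h \<in> borel_measurable borel" and p: "p permutes (UNIV :: 'n set)"
  shows "(\<integral>\<^sup>+ x. h (\<chi> i. x $ p i) \<partial>lborel) = (\<integral>\<^sup>+ x. h x \<partial>lborel)"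
proof -
  let ?f = "\<lambda>x :: real^'n. \<chi> i. x $ p i"
  have "linear ?f" by (rule linearI) (simp_all add: vec_eq_iff)
  then have [measurable]: "?f \<in> borel_measurable borel" by (rule borel_measurable_linear)
  have "lborel = distr lborel borel ?f"
  proof (rule lborel_eqI)
    fix l u :: "real^'n"
    assume le: "\<And>b. b \<in> Basis \<Longrightarrow> l \<bullet> b \<le> u \<bullet> b"
    let ?g = "\<lambda>x :: real^'n. \<chi> i. x $ (inv p) i"
    have le': "l $ i \<le> u $ i" for i using le[of "axis i 1"] by (simp add: inner_axis axis_in_Basis_iff)
    have "(\<forall>i. l $ i < x $ p i \<and> x $ p i < u $ i)
        \<longleftrightarrow> (\<forall>i. l $ inv p i < x $ i \<and> x $ i < u $ inv p i)" for x :: "real^'n"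
      using p by (metis permutes_inverses)
    then have "?f -` box l u = box (?g l) (?g u)"
      by (auto simp: mem_box_cart)
    then have "emeasure (distr lborel borel ?f) (box l u) = emeasure lborel (box (?g l) (?g u))"
      by (simp add: emeasure_distr)
    also have "\<dots> = (\<Prod>b\<in>Basis. (?g u - ?g l) \<bullet> b)"
    proof (rule emeasure_lborel_box)
      fix b :: "real^'n" assume "b \<in> Basis"
      then show "?g l \<bullet> b \<le> ?g u \<bullet> b" using le' by (auto simp: Basis_vec_def inner_axis)
    qed
    also have "(\<Prod>b\<in>Basis. (?g u - ?g l) \<bullet> b) = (\<Prod>i\<in>UNIV. (u - l) $ inv p i)"
      by (simp add: Basis_vec_def UNION_singleton_eq_range prod.reindex inner_axis axis_eq_axis inj_on_def)
    also have "\<dots> = (\<Prod>i\<in>UNIV. (u - l) $ i)"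
      using prod.permute[OF permutes_inv[OF p], of "\<lambda>i. (u - l) $ i"] by (simp add: o_def)
    also have "\<dots> = (\<Prod>b\<in>Basis. (u - l) \<bullet> b)"
      by (simp add: Basis_vec_def UNION_singleton_eq_range prod.reindex inner_axis axis_eq_axis inj_on_def)
    finally show "emeasure (distr lborel borel ?f) (box l u) = (\<Prod>b\<in>Basis. (u - l) \<bullet> b)" .
  qed simp
  then have "(\<integral>\<^sup>+ x. h x \<partial>lborel) = (\<integral>\<^sup>+ x. h x \<partial>(distr lborel borel ?f))" by simp
  also have "\<dots> = (\<integral>\<^sup>+ x. h (?f x) \<partial>lborel)" by (simp add: nn_integral_distr)
  finally show ?thesis by simp
qed

text \<open>Induction over elementary linear maps: composites, maps with a vanishing component,
  diagonal scalings, coordinate swaps and shears. The property \<open>Q\<close> includes the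
  determinant condition, which makes the singular case vacuous, and quantifies over
  \<open>h\<close>, because a composite needs the hypothesis for \<open>f\<close> at
  \<open>h\<close> and that for \<open>g\<close> at \<open>h \<circ> f\<close>.\<close>

lemma nn_integral_lborel_linear:
  fixes f :: "real^'n \<Rightarrow> real^'n"
  assumes "linear f" "det (matrix f) \<noteq> 0" "h \<in> borel_measurable borel"
  shows "(\<integral>\<^sup>+ x. h x \<partial>lborel) = ennreal \<bar>det (matrix f)\<bar> * (\<integral>\<^sup>+ x. h (f x) \<partial>lborel)"
proof -
  define Q where "Q f \<longleftrightarrow> (det (matrix f) \<noteq> 0 \<longrightarrow> (\<forall>h\<in>borel_measurable borel.
      (\<integral>\<^sup>+ x. h x \<partial>lborel) = ennreal \<bar>det (matrix f)\<bar> * (\<integral>\<^sup>+ x. h (f x) \<partial>lborel)))"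
    for f :: "real^'n \<Rightarrow> real^'n"
  have Q_dest: "(\<integral>\<^sup>+ x. h x \<partial>lborel) = ennreal \<bar>det (matrix f)\<bar> * (\<integral>\<^sup>+ x. h (f x) \<partial>lborel)"
    if "Q f" "det (matrix f) \<noteq> 0" "h \<in> borel_measurable borel" for f h
    using that unfolding Q_def by blast
  have "Q f"
  proof (rule induct_linear_elementary[OF \<open>linear f\<close>])
    fix f g :: "real^'n \<Rightarrow> real^'n"
    assume fg: "linear f" "linear g" and Q: "Q f" "Q g"
    have det: "det (matrix (f \<circ> g)) = det (matrix f) * det (matrix g)"
      using fg by (simp add: matrix_compose det_mul)
    show "Q (f \<circ> g)"
      unfolding Q_def
    proof (intro impI ballI)
      fix h :: "real^'n \<Rightarrow> ennreal"
      assume nz: "det (matrix (f \<circ> g)) \<noteq> 0" and [measurable]: "h \<in> borel_measurable borel"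
      have [measurable]: "f \<in> borel_measurable borel" using fg by (simp add: borel_measurable_linear)
      have "(\<integral>\<^sup>+ x. h x \<partial>lborel) = ennreal \<bar>det (matrix f)\<bar> * (\<integral>\<^sup>+ x. h (f x) \<partial>lborel)"
        by (rule Q_dest[OF Q(1)]) (use nz det in auto)
      also have "(\<integral>\<^sup>+ x. h (f x) \<partial>lborel)
          = ennreal \<bar>det (matrix g)\<bar> * (\<integral>\<^sup>+ x. h (f (g x)) \<partial>lborel)"
        by (rule Q_dest[OF Q(2)]) (use nz det in auto)
      finally show "(\<integral>\<^sup>+ x. h x \<partial>lborel)
          = ennreal \<bar>det (matrix (f \<circ> g))\<bar> * (\<integral>\<^sup>+ x. h ((f \<circ> g) x) \<partial>lborel)"
        by (simp add: det abs_mult ennreal_mult mult.assoc)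
    qed
  next
    fix f :: "real^'n \<Rightarrow> real^'n" and i
    assume f: "linear f" "\<And>x. f x $ i = 0"
    have "\<not> surj f"
    proof
      assume "surj f"
      then obtain x where "f x = axis i 1" by (metis surjD)
      then show False using f(2)[of x] by simp
    qed
    then have "det (matrix f) = 0"
      using det_nz_iff_inj[OF f(1)] linear_injective_imp_surjective[OF f(1)] by blast
    then show "Q f" by (simp add: Q_def)
  next
    fix c :: "'n \<Rightarrow> real"
    let ?f = "\<lambda>x :: real^'n. \<chi> i. c i * x $ i"
    have det: "det (matrix ?f) = (\<Prod>i\<in>UNIV. c i)"
      by (subst det_diagonal) (auto simp: matrix_def axis_def)
    show "Q ?f"
      unfolding Q_def
    proof (intro impI ballI)
      fix h :: "real^'n \<Rightarrow> ennreal"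
      assume nz: "det (matrix ?f) \<noteq> 0" and [measurable]: "h \<in> borel_measurable borel"
      \<comment> \<open>\<open>lborel_affine_euclidean\<close> indexes the scaling factors by basis
        vectors, so \<open>c\<close> is carried over from the index \<open>i\<close> to the vector
        \<open>axis i 1\<close>.\<close>
      define c' where "c' b = c (THE i. b = axis i 1)" for b :: "real^'n"
      have c': "c' (axis i 1) = c i" for i
        unfolding c'_def by (rule arg_cong[of _ _ c]) (auto simp: axis_eq_axis)
      define T where "T x = 0 + (\<Sum>j\<in>Basis. (c' j * (x \<bullet> j)) *\<^sub>R j)" for x :: "real^'n"
      have T: "T = ?f"
      proof
        fix x
        have "T x = (\<Sum>i\<in>UNIV. (c i * x $ i) *\<^sub>R axis i 1)"
          by (simp add: T_def Basis_vec_def UNION_singleton_eq_range sum.reindex axis_eq_axis inj_on_def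
              c' inner_axis)
        then show "T x = ?f x"
          by (simp add: vec_eq_iff axis_def if_distrib[where f="\<lambda>y. _ * y"] cong: if_cong)
      qed
      have "linear ?f" by (rule linearI) (simp_all add: vec_eq_iff algebra_simps)
      then have [measurable]: "?f \<in> borel_measurable borel" by (rule borel_measurable_linear)
      have prod: "(\<Prod>j\<in>Basis. \<bar>c' j\<bar>) = \<bar>det (matrix ?f)\<bar>"
        by (simp add: Basis_vec_def UNION_singleton_eq_range prod.reindex axis_eq_axis inj_on_def
              c' det abs_prod)
      have "c' j \<noteq> 0" if "j \<in> Basis" for j
        using that nz c' by (auto simp: Basis_vec_def det)
      then have "lborel = density (distr lborel borel T) (\<lambda>_. (\<Prod>j\<in>Basis. \<bar>c' j\<bar>))"
        unfolding T_def by (intro lborel_affine_euclidean) auto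
      then have "(\<integral>\<^sup>+ x. h x \<partial>lborel)
          = (\<integral>\<^sup>+ x. h x \<partial>(density (distr lborel borel ?f) (\<lambda>_. ennreal \<bar>det (matrix ?f)\<bar>)))"
        by (simp add: T prod)
      also have "\<dots> = ennreal \<bar>det (matrix ?f)\<bar> * (\<integral>\<^sup>+ x. h (?f x) \<partial>lborel)"
        by (simp add: nn_integral_density nn_integral_distr nn_integral_cmult)
      finally show "(\<integral>\<^sup>+ x. h x \<partial>lborel) = \<dots>" .
    qed
  next
    fix m n :: 'n assume "m \<noteq> n"
    let ?p = "Transposition.transpose m n"
    let ?f = "\<lambda>x :: real^'n. \<chi> i. x $ ?p i"
    have p: "?p permutes UNIV" by (rule permutes_swap_id) auto
    have "matrix ?f = (\<chi> i. mat 1 $ ?p i)"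
      by (auto simp: matrix_def axis_def mat_def vec_eq_iff)
    then have "det (matrix ?f) = of_int (sign ?p)"
      using det_permute_rows[OF p, of "mat 1 :: real^'n^'n"] by simp
    then have "\<bar>det (matrix ?f)\<bar> = 1"
      by (simp add: sign_def)
    then show "Q ?f"
      using nn_integral_lborel_permute[OF _ p] by (auto simp: Q_def)
  next
    fix m n :: 'n assume mn: "m \<noteq> n"
    let ?f = "\<lambda>x :: real^'n. \<chi> i. if i = m then x $ m + x $ n else x $ i"
    have "matrix ?f = (\<chi> k. if k = m then row m (mat 1) + 1 *s row n (mat 1) else row k (mat 1))"
      by (auto simp: matrix_def axis_def mat_def vec_eq_iff row_def)
    then have det: "det (matrix ?f) = 1"
      using det_row_operation[OF mn, of "mat 1 :: real^'n^'n" 1] by simp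
    have f: "?f = (\<lambda>x. x + (x \<bullet> axis n 1) *\<^sub>R axis m 1)"
    proof
      fix x :: "real^'n"
      have "x \<bullet> axis n 1 = x $ n" by (simp add: inner_axis)
      then show "?f x = x + (x \<bullet> axis n 1) *\<^sub>R axis m 1" by (auto simp: vec_eq_iff axis_def)
    qed
    show "Q ?f"
      unfolding Q_def det
      using nn_integral_lborel_shear[of _ "axis m (1::real)" "axis n 1"] mn
      by (simp add: axis_eq_axis fun_cong[OF f])
  qed
  then show ?thesis by (rule Q_dest) (use assms in auto)
qed

section \<open>Positive definite matrices\<close>

lemma matrix_inv_right:
  fixes A :: "real^'n^'n"
  assumes "invertible A"
  shows "A ** matrix_inv A = mat 1"
  using assms someI_ex[of "\<lambda>B. A ** B = mat 1 \<and> B ** A = mat 1"]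
  by (simp add: invertible_def matrix_inv_def)

lemma matrix_inv_left:
  fixes A :: "real^'n^'n"
  assumes "invertible A"
  shows "matrix_inv A ** A = mat 1"
  using assms someI_ex[of "\<lambda>B. A ** B = mat 1 \<and> B ** A = mat 1"]
  by (simp add: invertible_def matrix_inv_def)

lemma matrix_inv_unique:
  fixes A :: "real^'n^'n"
  assumes "A ** B = mat 1"
  shows "matrix_inv A = B"
proof -
  have "invertible A" using assms invertible_right_inverse by blast
  then have "matrix_inv A = matrix_inv A ** (A ** B)" by (simp add: assms)
  also have "\<dots> = B" using matrix_inv_left[OF \<open>invertible A\<close>] by (simp add: matrix_mul_assoc)
  finally show ?thesis .
qed

lemma posdef_invertible:
  assumes "posdef (A :: real^'n^'n)"
  shows "invertible A"
proof -
  have "x = 0" if "A *v x = 0" for x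
    using assms that unfolding posdef_def by force
  then have "inj ((*v) A)"
    by (simp add: linear_injective_0[OF matrix_vector_mul_linear])
  then show ?thesis
    using matrix_left_invertible_injective invertible_left_inverse by blast
qed

lemma psd_det_nonneg:
  assumes "psd (A :: real^'n^'n)"
  shows "0 \<le> det A"
  using det_mul[of "psd_sqrt A" "psd_sqrt A"] psd_sqrt(2)[OF assms] by simp

lemma posdef_det_pos:
  assumes "posdef (A :: real^'n^'n)"
  shows "0 < det A"
  using psd_det_nonneg[OF posdef_imp_psd[OF assms]] posdef_invertible[OF assms]
  by (simp add: invertible_det_nz)

lemma posdef_inv_cancel [simp]:
  assumes "posdef (A :: real^'n^'n)"
  shows "A *v (matrix_inv A *v x) = x" "matrix_inv A *v (A *v x) = x"
  using matrix_inv_right[OF posdef_invertible[OF assms]] matrix_inv_left[OF posdef_invertible[OF assms]]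
  by (simp_all add: matrix_vector_mul_assoc)

lemma posdef_matrix_inv:
  assumes "posdef (A :: real^'n^'n)"
  shows "posdef (matrix_inv A)"
proof -
  have sym: "transpose A = A" using assms by (simp add: posdef_def)
  show ?thesis
    unfolding posdef_def
  proof safe
    show "transpose (matrix_inv A) = matrix_inv A"
    proof (rule symmetricI)
      fix x y
      show "x \<bullet> (matrix_inv A *v y) = (matrix_inv A *v x) \<bullet> y"
        using symmetric_inner_commute[OF sym, of "matrix_inv A *v x" "matrix_inv A *v y"] assms
        by (simp add: inner_commute)
    qed
    fix x :: "real^'n" assume "x \<noteq> 0"
    then have "matrix_inv A *v x \<noteq> 0" using assms
      by (metis matrix_vector_mult_0_right posdef_inv_cancel(1))
    then have "0 < (matrix_inv A *v x) \<bullet> (A *v (matrix_inv A *v x))"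
      using assms unfolding posdef_def by blast
    then show "0 < x \<bullet> (matrix_inv A *v x)" using assms by (simp add: inner_commute)
  qed
qed

section \<open>Closure properties, bounds and perturbation of positive definite forms\<close>

lemma posdef_mat_1: "posdef (mat 1 :: real^'n^'n)"
  by (simp add: posdef_def)

lemma posdef_scaleR: "posdef A \<Longrightarrow> 0 < c \<Longrightarrow> posdef (c *\<^sub>R A)"
  by (simp add: posdef_def transpose_scaleR flip: scaleR_matrix_vector_assoc)

lemma psd_scaleR: "psd A \<Longrightarrow> 0 \<le> c \<Longrightarrow> psd (c *\<^sub>R A)"
  by (simp add: psd_def transpose_scaleR flip: scaleR_matrix_vector_assoc)

lemma posdef_add_psd: "posdef A \<Longrightarrow> psd B \<Longrightarrow> posdef (A + B)"
  by (simp add: posdef_def psd_def transpose_add matrix_vector_mult_add_rdistrib inner_add_right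
      add_pos_nonneg)

text \<open>The constant is the minimum of the form on the unit sphere, attained by compactness and
  hence positive.\<close>

lemma posdef_lower_bound:
  assumes "posdef (A :: real^'n^'n)"
  obtains c where "0 < c" "\<And>x. c * (x \<bullet> x) \<le> x \<bullet> (A *v x)"
proof -
  let ?S = "sphere 0 1 :: (real^'n) set"
  have "?S \<noteq> {}" by simp
  from continuous_attains_inf[OF compact_sphere this continuous_on_quadratic[of _ A]]
  obtain v where v: "norm v = 1"
    and min: "\<And>x. norm x = 1 \<Longrightarrow> v \<bullet> (A *v v) \<le> x \<bullet> (A *v x)"
    by auto
  show thesis
  proof
    show "0 < v \<bullet> (A *v v)" using assms v unfolding posdef_def by (metis norm_zero zero_neq_one)
    fix x :: "real^'n"
    show "v \<bullet> (A *v v) * (x \<bullet> x) \<le> x \<bullet> (A *v x)"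
    proof (cases "x = 0")
      case False
      have "v \<bullet> (A *v v) \<le> (x /\<^sub>R norm x) \<bullet> (A *v (x /\<^sub>R norm x))"
        by (rule min) (use False in auto)
      also have "\<dots> = (x \<bullet> (A *v x)) / (x \<bullet> x)"
        by (simp add: matrix_vector_mult_scaleR field_simps power2_norm_eq_inner[symmetric] power2_eq_square)
      finally show ?thesis using False by (simp add: field_simps)
    qed simp
  qed
qed

lemma quadratic_bound:
  fixes A :: "real^'n^'n"
  obtains c where "0 < c" "\<And>x. \<bar>x \<bullet> (A *v x)\<bar> \<le> c * (x \<bullet> x)"
proof -
  obtain K where K: "0 < K" "\<And>x. norm (A *v x) \<le> norm x * K"
    using bounded_linear.pos_bounded[OF matrix_vector_mul_bounded_linear[of A]] by blast
  have "\<bar>x \<bullet> (A *v x)\<bar> \<le> K * (x \<bullet> x)" for x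
  proof -
    have "\<bar>x \<bullet> (A *v x)\<bar> \<le> norm x * (norm x * K)"
      using Cauchy_Schwarz_ineq2[of x "A *v x"] mult_left_mono[OF K(2)[of x] norm_ge_zero[of x]] by linarith
    then show ?thesis by (simp add: power2_norm_eq_inner[symmetric] power2_eq_square mult_ac)
  qed
  then show thesis using that K by blast
qed

text \<open>Openness of positive definiteness: if \<open>c\<close> bounds the form of
  \<open>A\<close> from below and \<open>K\<close> bounds that of \<open>B\<close> in absolute
  value, every \<open>t\<close> of modulus below \<open>c / K\<close> is admissible.\<close>

lemma posdef_perturb:
  fixes A B :: "real^'n^'n"
  assumes "posdef A" "transpose B = B"
  obtains d where "0 < d" "\<And>t. \<bar>t\<bar> < d \<Longrightarrow> posdef (A - t *\<^sub>R B)"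
proof -
  obtain c where c: "0 < c" "\<And>x. c * (x \<bullet> x) \<le> x \<bullet> (A *v x)"
    using posdef_lower_bound[OF assms(1)] by blast
  obtain K where K: "0 < K" "\<And>x. \<bar>x \<bullet> (B *v x)\<bar> \<le> K * (x \<bullet> x)"
    using quadratic_bound by blast
  have "posdef (A - t *\<^sub>R B)" if t: "\<bar>t\<bar> < c / K" for t
    unfolding posdef_def
  proof safe
    show "transpose (A - t *\<^sub>R B) = A - t *\<^sub>R B"
      using assms by (simp add: transpose_diff transpose_scaleR posdef_def)
    fix x :: "real^'n" assume "x \<noteq> 0"
    then have xx: "0 < x \<bullet> x" by simp
    have "t * (x \<bullet> (B *v x)) \<le> \<bar>t\<bar> * \<bar>x \<bullet> (B *v x)\<bar>" by (metis abs_ge_self abs_mult)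
    also have "\<dots> \<le> \<bar>t\<bar> * (K * (x \<bullet> x))" by (intro mult_left_mono K) simp
    also have "\<dots> = (\<bar>t\<bar> * K) * (x \<bullet> x)" by simp
    also have "\<dots> < c * (x \<bullet> x)" using t K xx by (intro mult_strict_right_mono) (auto simp: field_simps)
    also have "\<dots> \<le> x \<bullet> (A *v x)" by (rule c)
    finally show "0 < x \<bullet> ((A - t *\<^sub>R B) *v x)"
      by (simp add: matrix_vector_mult_diff_rdistrib inner_diff_right flip: scaleR_matrix_vector_assoc)
  qed
  then show thesis using that[of "c / K"] c K by simp
qed

lemma det_scaleR: "det (c *\<^sub>R A) = c ^ CARD('n) * det (A :: real^'n^'n)"
proof -
  have "c *\<^sub>R A = mat c ** A"
    by (simp add: vec_eq_iff matrix_matrix_mult_def mat_def if_distrib[of "\<lambda>y. y * _"] cong: if_cong)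
  moreover have "det (mat c :: real^'n^'n) = c ^ CARD('n)"
    by (simp flip: matrix_scaleR)
  ultimately show ?thesis by (simp add: det_mul)
qed

lemma matrix_inv_scaleR:
  assumes "posdef (A :: real^'n^'n)" "c \<noteq> 0"
  shows "matrix_inv (c *\<^sub>R A) = (1 / c) *\<^sub>R matrix_inv A"
proof (rule matrix_inv_unique, rule matrix_eqI_vector)
  fix x
  show "(c *\<^sub>R A ** ((1 / c) *\<^sub>R matrix_inv A)) *v x = mat 1 *v x"
    using assms
    by (simp add: matrix_vector_mult_scaleR flip: matrix_vector_mul_assoc scaleR_matrix_vector_assoc)
qed

subsection \<open>Schur complements\<close>

lemma sum_UNIV_sum_type:
  fixes f :: "'a::finite + 'b::finite \<Rightarrow> real"
  shows "(\<Sum>k\<in>UNIV. f k) = (\<Sum>a\<in>UNIV. f (Inl a)) + (\<Sum>b\<in>UNIV. f (Inr b))"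
  by (simp add: UNIV_Plus_UNIV[symmetric] sum.Plus del: UNIV_Plus_UNIV)

definition block_vec :: "real^'a \<Rightarrow> real^'b \<Rightarrow> real^('a + 'b)" where
  "block_vec x y = (\<chi> k. case k of Inl a \<Rightarrow> x $ a | Inr b \<Rightarrow> y $ b)"

lemma block_vec_surj: "\<exists>x y. z = block_vec x y"
  by (rule exI[of _ "\<chi> a. z $ Inl a"], rule exI[of _ "\<chi> b. z $ Inr b"])
    (simp add: block_vec_def vec_eq_iff split: sum.split)

lemma block_quadratic:
  fixes A :: "real^'a^'a" and B :: "real^'b^'a" and C :: "real^'b^'b"
  assumes "z = block_vec x y"
  shows "z \<bullet> (vcat (hcat A B) (hcat (transpose B) C) *v z)
     = x \<bullet> (A *v x) + 2 * (x \<bullet> (B *v y)) + y \<bullet> (C *v y)"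
proof -
  have "vcat (hcat A B) (hcat (transpose B) C) *v z
      = block_vec (A *v x + B *v y) (transpose B *v x + C *v y)"
    by (simp add: assms vec_eq_iff block_vec_def vcat_def hcat_def matrix_vector_mult_def
        sum_UNIV_sum_type split: sum.split)
  moreover have "block_vec x y \<bullet> block_vec x' y' = x \<bullet> x' + y \<bullet> y'" for x' y'
    by (simp add: block_vec_def inner_vec_def sum_UNIV_sum_type)
  moreover have "y \<bullet> (transpose B *v x) = x \<bullet> (B *v y)"
    using inner_transpose[of x B y] by (simp add: inner_commute)
  ultimately show ?thesis by (simp add: assms inner_add_right)
qed

lemma block_transpose:
  fixes A :: "real^'a^'a" and B :: "real^'b^'a" and C :: "real^'b^'b"
  assumes "transpose A = A" "transpose C = C"
  shows "transpose (vcat (hcat A B) (hcat (transpose B) C)) = vcat (hcat A B) (hcat (transpose B) C)"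
  using assms by (simp add: transpose_def vcat_def hcat_def vec_eq_iff split: sum.split)

lemma psd_block_iff:
  fixes A :: "real^'a^'a" and B :: "real^'b^'a" and C :: "real^'b^'b"
  assumes "transpose A = A" "transpose C = C"
  shows "psd (vcat (hcat A B) (hcat (transpose B) C)) \<longleftrightarrow>
    (\<forall>x y. 0 \<le> x \<bullet> (A *v x) + 2 * (x \<bullet> (B *v y)) + y \<bullet> (C *v y))"
  unfolding psd_def block_transpose[OF assms]
  using block_quadratic[of _ _ _ A B C] block_vec_surj by metis

text \<open>Completing the square at \<open>x = - t *\<^sub>R (matrix_inv M *v b)\<close> leaves
  \<open>t\<^sup>2\<close> times the Schur complement
  \<open>h - b \<bullet> (matrix_inv M *v b)\<close>.\<close>

lemma psd_schur_scalar:
  fixes M :: "real^'k^'k" and b :: "real^'k" and h :: real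
  assumes M: "posdef M"
  shows "psd (vcat (hcat M (columnvector b :: real^1^'k)) (hcat (rowvector b) (mat h :: real^1^1)))
    \<longleftrightarrow> b \<bullet> (matrix_inv M *v b) \<le> h"
proof -
  have sym: "transpose M = M" using M by (simp add: posdef_def)
  have col: "x \<bullet> ((columnvector b :: real^1^'k) *v y) = (x \<bullet> b) * y $ 1" for x and y :: "real^1"
    by (simp add: inner_vec_def matrix_vector_mult_def columnvector_def sum_distrib_right UNIV_1 mult.assoc)
  have quad: "y \<bullet> (mat h *v y) = h * (y $ 1)\<^sup>2" for y :: "real^1"
    by (simp add: inner_vec_def matrix_vector_mult_def mat_def UNIV_1 power2_eq_square)
  have "psd (vcat (hcat M (columnvector b :: real^1^'k)) (hcat (rowvector b) (mat h :: real^1^1)))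
    \<longleftrightarrow> (\<forall>x y. 0 \<le> x \<bullet> (M *v x) + 2 * (x \<bullet> ((columnvector b :: real^1^'k) *v y)) + y \<bullet> (mat h *v y))"
    by (subst psd_block_iff[symmetric]) (auto simp: sym transpose_columnvector)
  also have "\<dots> \<longleftrightarrow> (\<forall>x (t :: real). 0 \<le> x \<bullet> (M *v x) + 2 * t * (x \<bullet> b) + h * t\<^sup>2)"
    unfolding col quad
  proof safe
    fix x t
    assume *: "\<forall>x (y :: real^1). 0 \<le> x \<bullet> (M *v x) + 2 * (x \<bullet> b * y $ 1) + h * (y $ 1)\<^sup>2"
    show "0 \<le> x \<bullet> (M *v x) + 2 * t * (x \<bullet> b) + h * t\<^sup>2"
      using *[rule_format, of x "vec t"] by (simp add: mult_ac)
  next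
    fix x and y :: "real^1"
    assume *: "\<forall>x t. 0 \<le> x \<bullet> (M *v x) + 2 * t * (x \<bullet> b) + h * t\<^sup>2"
    show "0 \<le> x \<bullet> (M *v x) + 2 * (x \<bullet> b * y $ 1) + h * (y $ 1)\<^sup>2"
      using *[rule_format, of x "y $ 1"] by (simp add: mult_ac)
  qed
  also have "\<dots> \<longleftrightarrow> b \<bullet> (matrix_inv M *v b) \<le> h"
  proof
    assume *: "\<forall>x t. 0 \<le> x \<bullet> (M *v x) + 2 * t * (x \<bullet> b) + h * t\<^sup>2"
    show "b \<bullet> (matrix_inv M *v b) \<le> h"
      using *[rule_format, of "matrix_inv M *v b" "-1"] M by (simp add: inner_commute)
  next
    assume le: "b \<bullet> (matrix_inv M *v b) \<le> h"
    show "\<forall>x t. 0 \<le> x \<bullet> (M *v x) + 2 * t * (x \<bullet> b) + h * t\<^sup>2"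
    proof safe
      fix x t
      let ?z = "x + t *\<^sub>R (matrix_inv M *v b)"
      have "0 \<le> ?z \<bullet> (M *v ?z)"
        using posdef_imp_psd[OF M] by (simp add: psd_def)
      also have "?z \<bullet> (M *v ?z) = x \<bullet> (M *v x) + 2 * t * (x \<bullet> b) + (b \<bullet> (matrix_inv M *v b)) * t\<^sup>2"
        using M symmetric_inner_commute[OF sym, of "matrix_inv M *v b" x]
        by (simp add: matrix_vector_right_distrib matrix_vector_mult_scaleR inner_add_left inner_add_right
            inner_commute power2_eq_square algebra_simps)
      also have "\<dots> \<le> x \<bullet> (M *v x) + 2 * t * (x \<bullet> b) + h * t\<^sup>2"
        using le by (simp add: mult_right_mono)
      finally show "0 \<le> x \<bullet> (M *v x) + 2 * t * (x \<bullet> b) + h * t\<^sup>2" .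
    qed
  qed
  finally show ?thesis .
qed

text \<open>With the identity in the lower right corner the form is minimal over \<open>y\<close> at
  \<open>- (F *v x)\<close>, where it equals the difference of the forms of \<open>Q\<close> and
  \<open>transpose F ** F\<close>.\<close>

lemma psd_schur_identity:
  fixes Q :: "real^'k^'k" and F :: "real^'k^'q"
  assumes "transpose Q = Q"
  shows "psd (vcat (hcat Q (transpose F)) (hcat F (mat 1))) \<longleftrightarrow>
    (\<forall>x. x \<bullet> ((transpose F ** F) *v x) \<le> x \<bullet> (Q *v x))"
proof -
  have FF: "x \<bullet> ((transpose F ** F) *v x) = (F *v x) \<bullet> (F *v x)" for x
    by (simp only: matrix_vector_mul_assoc[symmetric] inner_transpose[of x "transpose F"] transpose_transpose)
  have F: "x \<bullet> (transpose F *v y) = (F *v x) \<bullet> y" for x y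
    by (simp only: inner_transpose[of x "transpose F"] transpose_transpose)
  have "psd (vcat (hcat Q (transpose F)) (hcat F (mat 1)))
    \<longleftrightarrow> (\<forall>x y. 0 \<le> x \<bullet> (Q *v x) + 2 * ((F *v x) \<bullet> y) + y \<bullet> y)"
    using psd_block_iff[of Q "mat 1" "transpose F"] assms unfolding F by simp
  also have "\<dots> \<longleftrightarrow> (\<forall>x. (F *v x) \<bullet> (F *v x) \<le> x \<bullet> (Q *v x))"
  proof safe
    fix x
    assume "\<forall>x y. 0 \<le> x \<bullet> (Q *v x) + 2 * ((F *v x) \<bullet> y) + y \<bullet> y"
    from this[rule_format, of x "- (F *v x)"] show "(F *v x) \<bullet> (F *v x) \<le> x \<bullet> (Q *v x)" by simp
  next
    fix x y
    assume "\<forall>x. (F *v x) \<bullet> (F *v x) \<le> x \<bullet> (Q *v x)"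
    moreover have "0 \<le> (F *v x + y) \<bullet> (F *v x + y)" by simp
    ultimately show "0 \<le> x \<bullet> (Q *v x) + 2 * ((F *v x) \<bullet> y) + y \<bullet> y"
      unfolding inner_add_left inner_add_right
      by (smt (verit) inner_commute)
  qed
  finally show ?thesis by (simp add: FF)
qed

section \<open>Gaussian integrals\<close>

lemma nn_integral_exp_neg_square:
  "(\<integral>\<^sup>+ x. ennreal (exp (- x\<^sup>2)) \<partial>lborel) = ennreal (sqrt pi)"
proof -
  \<comment> \<open>The normal density of variance 1/2 has exactly this exponent.\<close>
  have "exp (- x\<^sup>2) = sqrt pi * normal_density 0 (1 / sqrt 2) x" for x :: real
    by (simp add: normal_density_def power_divide)
  then have "(\<integral>\<^sup>+ x. ennreal (exp (- x\<^sup>2)) \<partial>lborel)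
      = (\<integral>\<^sup>+ x. ennreal (sqrt pi) * ennreal (normal_density 0 (1 / sqrt 2) x) \<partial>lborel)"
    by (simp add: ennreal_mult)
  also have "\<dots> = ennreal (sqrt pi) * (\<integral>\<^sup>+ x. ennreal (normal_density 0 (1 / sqrt 2) x) \<partial>lborel)"
    by (rule nn_integral_cmult) simp
  also have "(\<integral>\<^sup>+ x. ennreal (normal_density 0 (1 / sqrt 2) x) \<partial>lborel) = 1"
    by (subst nn_integral_eq_integral) simp_all
  finally show ?thesis by simp
qed

lemma nn_integral_exp_neg_inner:
  "(\<integral>\<^sup>+ x. ennreal (exp (- (x \<bullet> x))) \<partial>(lborel :: (real^'n) measure)) = ennreal (sqrt pi ^ CARD('n))"
proof -
  have "ennreal (exp (- (x \<bullet> x))) = (\<Prod>b\<in>Basis. ennreal (exp (- (x \<bullet> b)\<^sup>2)))" for x :: "real^'n"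
    by (simp add: prod_ennreal euclidean_inner[of x x] power2_eq_square flip: exp_sum sum_negf)
  then have "(\<integral>\<^sup>+ x. ennreal (exp (- (x \<bullet> x))) \<partial>(lborel :: (real^'n) measure))
      = (\<integral>\<^sup>+ x. (\<Prod>b\<in>Basis. ennreal (exp (- (x \<bullet> b)\<^sup>2))) \<partial>(lborel :: (real^'n) measure))"
    by simp
  also have "\<dots> = (\<Prod>b\<in>(Basis :: (real^'n) set). (\<integral>\<^sup>+ x. ennreal (exp (- x\<^sup>2)) \<partial>lborel))"
    by (rule nn_integral_lborel_prod) simp_all
  also have "\<dots> = ennreal (sqrt pi ^ CARD('n))"
    by (simp add: nn_integral_exp_neg_square ennreal_power)
  finally show ?thesis .
qed

lemma borel_measurable_matrix_vector [measurable]: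
  fixes A :: "real^'n^'m"
  shows "(\<lambda>x. A *v x) \<in> borel_measurable borel"
  by (intro borel_measurable_linear matrix_vector_mul_linear)

text \<open>Translation by the maximizer \<open>matrix_inv M *v b\<close> completes the square. The
  substitution by the square root \<open>R\<close> of \<open>M\<close>, whose determinant has
  modulus \<open>sqrt (det M)\<close>, then reduces to the rotationally symmetric integral.\<close>

lemma nn_integral_gaussian_exponent:
  fixes M :: "real^'n^'n" and b :: "real^'n"
  assumes M: "posdef M"
  shows "(\<integral>\<^sup>+ y. ennreal (exp (2 * (b \<bullet> y) - y \<bullet> (M *v y))) \<partial>lborel)
    = ennreal (exp (b \<bullet> (matrix_inv M *v b)) * sqrt pi ^ CARD('n) / sqrt (det M))"
proof -
  define R where "R = psd_sqrt M"
  have R: "transpose R = R" "R ** R = M"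
    using psd_sqrt[OF posdef_imp_psd[OF M]] by (auto simp: R_def psd_def)
  have "det R * det R = det M" by (simp add: R flip: det_mul)
  then have det: "\<bar>det R\<bar> = sqrt (det M)" by (simp flip: power2_eq_square real_sqrt_abs)
  then have nz: "det R \<noteq> 0" using posdef_det_pos[OF M] by auto
  define a where "a = matrix_inv M *v b"
  have Ma: "M *v a = b" using M by (simp add: a_def)
  have sym: "transpose M = M" using M by (simp add: posdef_def)
  have expo: "2 * (b \<bullet> (a + y)) - (a + y) \<bullet> (M *v (a + y)) = b \<bullet> a - (R *v y) \<bullet> (R *v y)" for y
  proof -
    have "(R *v y) \<bullet> (R *v y) = y \<bullet> (M *v y)"
      by (simp add: inner_transpose[of y R] R(1) flip: R(2) matrix_vector_mul_assoc)
    moreover have "a \<bullet> (M *v y) = b \<bullet> y"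
      using symmetric_inner_commute[OF sym, of a y] by (simp add: Ma inner_commute)
    ultimately show ?thesis
      by (simp add: matrix_vector_right_distrib inner_add_left inner_add_right Ma inner_commute)
  qed
  let ?f = "\<lambda>y. ennreal (exp (2 * (b \<bullet> y) - y \<bullet> (M *v y)))"
  have "(\<integral>\<^sup>+ y. ?f y \<partial>lborel) = (\<integral>\<^sup>+ y. ?f y \<partial>(distr lborel borel ((+) a)))"
    by (simp add: lborel_distr_plus)
  also have "\<dots> = (\<integral>\<^sup>+ y. ?f (a + y) \<partial>lborel)"
    by (rule nn_integral_distr) simp_all
  also have "\<dots> = (\<integral>\<^sup>+ y. ennreal (exp (b \<bullet> a)) * ennreal (exp (- ((R *v y) \<bullet> (R *v y)))) \<partial>lborel)"
    unfolding expo by (simp only: diff_conv_add_uminus exp_add ennreal_mult exp_ge_zero)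
  also have "\<dots> = ennreal (exp (b \<bullet> a)) * (\<integral>\<^sup>+ y. ennreal (exp (- ((R *v y) \<bullet> (R *v y)))) \<partial>lborel)"
    by (rule nn_integral_cmult) simp
  also have "(\<integral>\<^sup>+ y. ennreal (exp (- ((R *v y) \<bullet> (R *v y)))) \<partial>lborel)
      = ennreal (sqrt pi ^ CARD('n) / sqrt (det M))"
  proof -
    have "ennreal (sqrt pi ^ CARD('n)) = (\<integral>\<^sup>+ y. ennreal (exp (- (y \<bullet> y))) \<partial>(lborel :: (real^'n) measure))"
      by (simp add: nn_integral_exp_neg_inner)
    also have "\<dots> = ennreal \<bar>det (matrix ((*v) R))\<bar> * (\<integral>\<^sup>+ y. ennreal (exp (- ((R *v y) \<bullet> (R *v y)))) \<partial>lborel)"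
      by (rule nn_integral_lborel_linear) (use nz in \<open>simp_all add: matrix_vector_mul_linear\<close>)
    finally have "ennreal (sqrt pi ^ CARD('n))
        = ennreal (sqrt (det M)) * (\<integral>\<^sup>+ y. ennreal (exp (- ((R *v y) \<bullet> (R *v y)))) \<partial>lborel)"
      by (simp add: det)
    then have "ennreal (sqrt pi ^ CARD('n)) / ennreal (sqrt (det M))
        = ennreal (sqrt (det M)) * (\<integral>\<^sup>+ y. ennreal (exp (- ((R *v y) \<bullet> (R *v y)))) \<partial>lborel)
          / ennreal (sqrt (det M))"
      by simp
    moreover have "ennreal (sqrt (det M)) \<noteq> 0" using posdef_det_pos[OF M] by simp
    ultimately show ?thesis using posdef_det_pos[OF M]
      by (simp add: divide_ennreal mult.commute[of "ennreal (sqrt (det M))"] mult_divide_eq_ennreal)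
  qed
  finally show ?thesis
    using posdef_det_pos[OF M] by (simp add: a_def ennreal_mult[symmetric])
qed

section \<open>Smoothness of determinants and inverses along a line\<close>

lemma differentiable_det:
  fixes A :: "real \<Rightarrow> real^'n^'n"
  assumes "\<And>i j. (\<lambda>t. A t $ i $ j) differentiable (at x)"
  shows "(\<lambda>t. det (A t)) differentiable (at x)"
proof -
  have "(\<lambda>t. \<Prod>i\<in>S. A t $ i $ p i) differentiable (at x)" if "finite S" for p and S :: "'n set"
    using that by induction (use assms in \<open>auto intro!: differentiable_mult\<close>)
  then show ?thesis
    unfolding det_def by (intro differentiable_sum differentiable_mult) auto
qed

text \<open>Cramer's rule exhibits the form as a rational function of the entries of
  \<open>M\<close>, from which differentiability along a curve of matrices follows.\<close>

lemma quadratic_matrix_inv_cramer: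
  fixes M :: "real^'n^'n"
  assumes "det M \<noteq> 0"
  shows "b \<bullet> (matrix_inv M *v b) = (\<Sum>k\<in>UNIV. b $ k * (det (\<chi> i j. if j = k then b $ i else M $ i $ j) / det M))"
proof -
  have "invertible M" using assms by (simp add: invertible_det_nz)
  then have "M *v (matrix_inv M *v b) = b"
    by (simp add: matrix_vector_mul_assoc matrix_inv_right)
  then show ?thesis
    using cramer[OF assms, of "matrix_inv M *v b" b] by (simp add: inner_vec_def)
qed

lemma differentiable_quadratic_matrix_inv:
  fixes A :: "real \<Rightarrow> real^'n^'n"
  assumes A: "\<And>i j. (\<lambda>t. A t $ i $ j) differentiable (at x)" and "det (A x) \<noteq> 0"
  shows "(\<lambda>t. b \<bullet> (matrix_inv (A t) *v b)) differentiable (at x)"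
proof -
  have det: "(\<lambda>t. det (A t)) differentiable (at x)" by (rule differentiable_det[OF A])
  have "(\<lambda>t. det (\<chi> i j. if j = k then b $ i else A t $ i $ j)) differentiable (at x)" for k
  proof (rule differentiable_det)
    fix i j
    show "(\<lambda>t. (\<chi> i j. if j = k then b $ i else A t $ i $ j) $ i $ j) differentiable (at x)"
      using A by (cases "j = k") simp_all
  qed
  then have *: "(\<lambda>t. \<Sum>k\<in>UNIV. b $ k * (det (\<chi> i j. if j = k then b $ i else A t $ i $ j) / det (A t)))
      differentiable (at x)"
    by (intro differentiable_sum differentiable_mult differentiable_divide) (use det assms(2) in auto)
  have "isCont (\<lambda>t. det (A t)) x" using det differentiable_imp_continuous_within by blast
  \<comment> \<open>Cramer's formula holds where the determinant is nonzero; by continuity this is a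
    neighbourhood of \<open>x\<close>, enough to transfer the derivative.\<close>
  then have "\<forall>\<^sub>F t in nhds x. det (A t) \<noteq> 0"
    using assms(2) by (simp add: isCont_def tendsto_imp_eventually_ne eventually_nhds_conv_at)
  then have ev: "\<forall>\<^sub>F t in nhds x. (\<Sum>k\<in>UNIV. b $ k * (det (\<chi> i j. if j = k then b $ i else A t $ i $ j) / det (A t)))
      = b \<bullet> (matrix_inv (A t) *v b)"
    by eventually_elim (simp add: quadratic_matrix_inv_cramer)
  from * obtain D where "((\<lambda>t. \<Sum>k\<in>UNIV. b $ k * (det (\<chi> i j. if j = k then b $ i else A t $ i $ j) / det (A t)))
      has_real_derivative D) (at x)"
    by (auto simp: real_differentiable_def)
  then have "((\<lambda>t. b \<bullet> (matrix_inv (A t) *v b)) has_real_derivative D) (at x)"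
    using DERIV_cong_ev[OF refl ev refl] by blast
  then show ?thesis by (auto simp: real_differentiable_def)
qed

section \<open>The Gibbs kernel of the Gaussian reference measure\<close>

locale gaussian_reference =
  fixes m :: "real^'k" and \<Sigma> :: "real^'k^'k" and \<epsilon> :: real
  assumes posdef_cov: "posdef \<Sigma>" and eps_pos: "0 < \<epsilon>"
begin

text \<open>The exponent \<open>(y \<bullet> (X *v y) - (x - y) \<bullet> (x - y)) /
  \<epsilon>\<close> combined with that of the Gaussian density has quadratic part
  \<open>- (y \<bullet> ((K - X) *v y)) / \<epsilon>\<close> and linear part
  \<open>2 * (shift x \<bullet> y) / \<epsilon>\<close>. Positive definiteness of
  \<open>K - X\<close> therefore makes its exponential integrable.\<close>

definition K :: "real^'k^'k" where
  "K = mat 1 + (\<epsilon> / 2) *\<^sub>R matrix_inv \<Sigma>"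

definition shift :: "real^'k \<Rightarrow> real^'k" where
  "shift x = x + (\<epsilon> / 2) *\<^sub>R (matrix_inv \<Sigma> *v m)"

text \<open>The soft maximum \<open>\<epsilon> ln \<integral> exp ((y\<^sup>T X y - \<parallel>x - y\<parallel>\<^sup>2) / \<epsilon>) d\<nu>(y)\<close>, evaluated in closed form.\<close>

definition softmax :: "real^'k^'k \<Rightarrow> real^'k \<Rightarrow> real" where
  "softmax X x = \<epsilon> * CARD('k) / 2 * ln (\<epsilon> / 2) - \<epsilon> / 2 * ln (det \<Sigma>) - \<epsilon> / 2 * ln (det (K - X))
     + shift x \<bullet> (matrix_inv (K - X) *v shift x) - x \<bullet> x - \<epsilon> / 2 * (m \<bullet> (matrix_inv \<Sigma> *v m))"

text \<open>Logarithm of the conditional density of \<open>y\<close> given \<open>x\<close> with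
  respect to the reference measure; subtracting \<open>softmax X x\<close> normalizes it.\<close>

definition gibbs :: "real^'k^'k \<Rightarrow> real^'k \<Rightarrow> real^'k \<Rightarrow> real" where
  "gibbs X x y = (y \<bullet> (X *v y) - (x - y) \<bullet> (x - y) - softmax X x) / \<epsilon>"

lemma posdef_K: "posdef K"
  unfolding K_def
  by (intro posdef_add_psd posdef_mat_1 psd_scaleR posdef_imp_psd posdef_matrix_inv posdef_cov)
    (use eps_pos in simp)

text \<open>Merges the two log-determinants of \<open>softmax 0\<close> into the single one of the
  feasibility threshold.\<close>

lemma det_K: "det K * det \<Sigma> = det (\<Sigma> + (\<epsilon> / 2) *\<^sub>R mat 1)"
proof -
  have "K ** \<Sigma> = \<Sigma> + (\<epsilon> / 2) *\<^sub>R mat 1"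
    by (rule matrix_eqI_vector)
      (simp add: K_def matrix_vector_mult_add_rdistrib posdef_cov
        flip: matrix_vector_mul_assoc scaleR_matrix_vector_assoc)
  then show ?thesis by (simp flip: det_mul)
qed

lemma nn_integral_gaussian:
  assumes "f \<in> borel_measurable borel"
  shows "(\<integral>\<^sup>+ y. f y \<partial>gaussian m \<Sigma>) = (\<integral>\<^sup>+ y. ennreal
     (exp (- ((y - m) \<bullet> (matrix_inv \<Sigma> *v (y - m))) / 2) / sqrt ((2 * pi) ^ CARD('k) * det \<Sigma>)) * f y \<partial>lborel)"
  unfolding gaussian_def using assms by (intro nn_integral_density) simp_all

text \<open>Brings the exponent relative to Lebesgue measure into the shape of
  \<open>nn_integral_gaussian_exponent\<close>, up to a term constant in \<open>y\<close>.\<close>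

lemma gibbs_exponent:
  "- ((y - m) \<bullet> (matrix_inv \<Sigma> *v (y - m))) / 2 + gibbs X x y
   = (2 * (((1 / \<epsilon>) *\<^sub>R shift x) \<bullet> y) - y \<bullet> (((1 / \<epsilon>) *\<^sub>R (K - X)) *v y))
     - (x \<bullet> x + \<epsilon> / 2 * (m \<bullet> (matrix_inv \<Sigma> *v m)) + softmax X x) / \<epsilon>"
proof -
  have sym: "transpose (matrix_inv \<Sigma>) = matrix_inv \<Sigma>"
    using posdef_matrix_inv[OF posdef_cov] by (simp add: posdef_def)
  have c: "y \<bullet> (matrix_inv \<Sigma> *v m) = m \<bullet> (matrix_inv \<Sigma> *v y)" by (rule symmetric_inner_commute[OF sym])
  have c': "(matrix_inv \<Sigma> *v m) \<bullet> y = m \<bullet> (matrix_inv \<Sigma> *v y)" using c by (simp add: inner_commute)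
  have q: "(y - m) \<bullet> (matrix_inv \<Sigma> *v (y - m))
      = y \<bullet> (matrix_inv \<Sigma> *v y) - 2 * (m \<bullet> (matrix_inv \<Sigma> *v y)) + m \<bullet> (matrix_inv \<Sigma> *v m)"
    by (simp add: matrix_vector_mult_diff_distrib inner_diff_left inner_diff_right c)
  have k: "((1 / \<epsilon>) *\<^sub>R (K - X)) *v y
      = (1 / \<epsilon>) *\<^sub>R (y + (\<epsilon> / 2) *\<^sub>R (matrix_inv \<Sigma> *v y) - X *v y)"
    by (simp add: K_def matrix_vector_mult_add_rdistrib matrix_vector_mult_diff_rdistrib
        flip: scaleR_matrix_vector_assoc)
  have s: "((1 / \<epsilon>) *\<^sub>R shift x) \<bullet> y = (x \<bullet> y + \<epsilon> / 2 * (m \<bullet> (matrix_inv \<Sigma> *v y))) / \<epsilon>"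
    by (simp add: shift_def inner_add_left c')
  show ?thesis
    unfolding q k s gibbs_def using eps_pos
    by (simp add: inner_add_left inner_add_right inner_diff_left inner_diff_right inner_commute[of y x] field_simps)
qed

text \<open>This justifies the closed form of \<open>softmax\<close>: its constants are exactly
  those that normalize the Gaussian integral.\<close>

lemma nn_integral_exp_gibbs:
  assumes X: "posdef (K - X)"
  shows "(\<integral>\<^sup>+ y. ennreal (exp (gibbs X x y)) \<partial>gaussian m \<Sigma>) = 1"
proof -
  let ?M = "(1 / \<epsilon>) *\<^sub>R (K - X)" and ?b = "(1 / \<epsilon>) *\<^sub>R shift x"
  let ?c = "(x \<bullet> x + \<epsilon> / 2 * (m \<bullet> (matrix_inv \<Sigma> *v m)) + softmax X x) / \<epsilon>"
  let ?s = "sqrt ((2 * pi) ^ CARD('k) * det \<Sigma>)"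
  define n where "n = real CARD('k)"
  have dS: "0 < det \<Sigma>" and dM: "0 < det (K - X)"
    using posdef_det_pos posdef_cov X by auto
  have sp: "0 < ?s" using dS by simp
  have M: "posdef ?M" using X eps_pos by (simp add: posdef_scaleR)
  have [measurable]: "(\<lambda>y. gibbs X x y) \<in> borel_measurable borel"
    unfolding gibbs_def by measurable
  have "(\<integral>\<^sup>+ y. ennreal (exp (gibbs X x y)) \<partial>gaussian m \<Sigma>)
      = (\<integral>\<^sup>+ y. ennreal (exp (- ?c) / ?s) * ennreal (exp (2 * (?b \<bullet> y) - y \<bullet> (?M *v y))) \<partial>lborel)"
  proof (subst nn_integral_gaussian, measurable, rule nn_integral_cong)
    fix y
    have "exp (- ((y - m) \<bullet> (matrix_inv \<Sigma> *v (y - m))) / 2) * exp (gibbs X x y)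
        = exp (- ?c) * exp (2 * (?b \<bullet> y) - y \<bullet> (?M *v y))"
      unfolding exp_add[symmetric] gibbs_exponent by (simp add: algebra_simps)
    then show "ennreal (exp (- ((y - m) \<bullet> (matrix_inv \<Sigma> *v (y - m))) / 2) / ?s) * ennreal (exp (gibbs X x y))
      = ennreal (exp (- ?c) / ?s) * ennreal (exp (2 * (?b \<bullet> y) - y \<bullet> (?M *v y)))"
      using sp by (simp add: ennreal_mult[symmetric])
  qed
  also have "\<dots> = ennreal (exp (- ?c) / ?s) * (\<integral>\<^sup>+ y. ennreal (exp (2 * (?b \<bullet> y) - y \<bullet> (?M *v y))) \<partial>lborel)"
    by (rule nn_integral_cmult) simp
  also have "\<dots> = ennreal (exp (- ?c) / ?s * (exp (?b \<bullet> (matrix_inv ?M *v ?b)) * sqrt pi ^ CARD('k) / sqrt (det ?M)))"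
    unfolding nn_integral_gaussian_exponent[OF M] using sp posdef_det_pos[OF M]
    by (intro ennreal_mult[symmetric]) simp_all
  also have "exp (- ?c) / ?s * (exp (?b \<bullet> (matrix_inv ?M *v ?b)) * sqrt pi ^ CARD('k) / sqrt (det ?M)) = 1"
  proof -
    define q where "q = shift x \<bullet> (matrix_inv (K - X) *v shift x)"
    have q: "?b \<bullet> (matrix_inv ?M *v ?b) = q / \<epsilon>"
      using matrix_inv_scaleR[OF X, of "1 / \<epsilon>"] eps_pos
      by (simp add: q_def matrix_vector_mult_scaleR flip: scaleR_matrix_vector_assoc)
    \<comment> \<open>All factors are positive and are rewritten as exponentials, so that the
      product being 1 becomes a linear identity between logarithms.\<close>
    have sq: "sqrt z = exp (ln z / 2)" if "0 < z" for z :: real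
      using that by (simp flip: ln_sqrt)
    have pw: "sqrt pi ^ CARD('k) = exp (n * (ln pi / 2))"
      unfolding n_def exp_of_nat_mult by (simp add: sq)
    have s: "?s = exp ((n * (ln 2 + ln pi) + ln (det \<Sigma>)) / 2)"
      using dS by (subst sq) (simp_all add: ln_mult ln_realpow n_def algebra_simps)
    have dt: "sqrt (det ?M) = exp ((ln (det (K - X)) - n * ln \<epsilon>) / 2)"
      using dM eps_pos by (subst sq) (simp_all add: det_scaleR ln_mult ln_realpow ln_div n_def power_divide)
    have c: "?c = (q + \<epsilon> * n / 2 * (ln \<epsilon> - ln 2) - \<epsilon> / 2 * ln (det \<Sigma>) - \<epsilon> / 2 * ln (det (K - X))) / \<epsilon>"
      using eps_pos by (simp add: softmax_def q_def n_def ln_div)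
    have "- ?c - (n * (ln 2 + ln pi) + ln (det \<Sigma>)) / 2 + (q / \<epsilon> + n * (ln pi / 2)
        - (ln (det (K - X)) - n * ln \<epsilon>) / 2) = 0"
      unfolding c using eps_pos by (simp add: field_simps)
    then show ?thesis
      unfolding q pw s dt by (simp flip: exp_add exp_diff)
  qed
  finally show ?thesis by simp
qed

end

section \<open>Entropic transport from the empirical distribution\<close>

text \<open>One half of the Donsker-Varadhan principle. With \<open>D\<close> the density of
  \<gamma>, integrate \<open>f - ln D \<le> exp f / D - 1\<close> against \<gamma>; the integral of
  \<open>exp f / D\<close> is at most that of \<open>exp f\<close> against \<mu>, hence at most
  1.\<close>

lemma gibbs_inequality:
  assumes "sigma_finite_measure \<mu>" and \<gamma>: "prob_space \<gamma>" and sets: "sets \<gamma> = sets \<mu>"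
    and ac: "absolutely_continuous \<mu> \<gamma>" and ent: "integrable \<gamma> (entropy_density (exp 1) \<mu> \<gamma>)"
    and f: "integrable \<gamma> f" and le1: "(\<integral>\<^sup>+ z. ennreal (exp (f z)) \<partial>\<mu>) \<le> 1"
  shows "(\<integral> z. f z \<partial>\<gamma>) \<le> KL_divergence (exp 1) \<mu> \<gamma>"
proof -
  interpret sigma_finite_measure \<mu> by fact
  interpret \<gamma>: prob_space \<gamma> by fact
  have fm: "f \<in> borel_measurable \<mu>"
    using borel_measurable_integrable[OF f] measurable_cong_sets[OF sets refl] by blast
  obtain D where D: "D \<in> borel_measurable \<mu>" "AE z in \<mu>. RN_deriv \<mu> \<gamma> z = ennreal (D z)"
    "AE z in \<gamma>. 0 < D z" "\<And>z. 0 \<le> D z"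
    using real_RN_deriv[OF \<gamma>.finite_measure_axioms ac sets] by blast
  note [measurable] = D(1) fm
  have "density \<mu> (RN_deriv \<mu> \<gamma>) = \<gamma>" using ac sets by (rule density_RN_deriv)
  moreover have "density \<mu> (RN_deriv \<mu> \<gamma>) = density \<mu> (\<lambda>z. ennreal (D z))"
    using D(2) by (intro density_cong) auto
  ultimately have \<gamma>_eq: "density \<mu> (\<lambda>z. ennreal (D z)) = \<gamma>" by simp
  have ed: "AE z in \<gamma>. entropy_density (exp 1) \<mu> \<gamma> z = ln (D z)"
    using absolutely_continuous_AE[OF sets ac D(2)]
    by eventually_elim (simp add: entropy_density_def D(4) log_def)
  let ?r = "\<lambda>z. exp (f z) / D z"
  have "(\<integral>\<^sup>+ z. ennreal (?r z) \<partial>\<gamma>) = (\<integral>\<^sup>+ z. ennreal (D z) * ennreal (?r z) \<partial>\<mu>)"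
    unfolding \<gamma>_eq[symmetric] by (rule nn_integral_density) simp_all
  \<comment> \<open>Only an inequality, because the product on the left is 0 where \<open>D\<close>
    vanishes.\<close>
  also have "\<dots> \<le> (\<integral>\<^sup>+ z. ennreal (exp (f z)) \<partial>\<mu>)"
    using D(4) by (intro nn_integral_mono) (simp add: ennreal_mult[symmetric])
  finally have r1: "(\<integral>\<^sup>+ z. ennreal (?r z) \<partial>\<gamma>) \<le> 1" using le1 by simp
  have rm: "?r \<in> borel_measurable \<gamma>"
    using measurable_cong_sets[OF sets refl, of "borel :: real measure"] by auto
  have int_r: "integrable \<gamma> ?r"
    using r1 D(4) rm by (intro integrableI_nonneg) (auto simp: le_less_trans[OF _ ennreal_one_less_top])
  have "(\<integral> z. ?r z \<partial>\<gamma>) \<le> 1"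
  proof -
    have "ennreal (\<integral> z. ?r z \<partial>\<gamma>) = (\<integral>\<^sup>+ z. ennreal (?r z) \<partial>\<gamma>)"
      using int_r D(4) by (intro nn_integral_eq_integral[symmetric]) auto
    then have "ennreal (\<integral> z. ?r z \<partial>\<gamma>) \<le> ennreal 1" using r1 by simp
    then show ?thesis by (subst (asm) ennreal_le_iff) auto
  qed
  then have "0 \<ge> (\<integral> z. ?r z - 1 \<partial>\<gamma>)" using int_r by (simp add: \<gamma>.prob_space)
  also have "(\<integral> z. ?r z - 1 \<partial>\<gamma>) \<ge> (\<integral> z. f z - entropy_density (exp 1) \<mu> \<gamma> z \<partial>\<gamma>)"
  proof (rule integral_mono_AE)
    show "AE z in \<gamma>. f z - entropy_density (exp 1) \<mu> \<gamma> z \<le> ?r z - 1"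
      using ed D(3)
    proof eventually_elim
      case (elim z)
      have "f z - ln (D z) \<le> exp (f z - ln (D z)) - 1"
        using exp_ge_add_one_self[of "f z - ln (D z)"] by linarith
      then show ?case using elim by (simp add: exp_diff)
    qed
  qed (use f ent int_r in auto)
  finally show ?thesis using f ent by (simp add: KL_divergence_def)
qed

section \<open>Integration against the empirical and the Gaussian measure\<close>

lemma sets_empirical [simp, measurable_cong]: "sets (empirical n w) = sets borel"
  by (simp add: empirical_def)

lemma space_empirical [simp]: "space (empirical n w) = UNIV"
  by (simp add: empirical_def)

lemma nn_integral_empirical:
  assumes "1 \<le> n" and [measurable]: "f \<in> borel_measurable borel"
  shows "(\<integral>\<^sup>+ x. f x \<partial>empirical n w) = (\<Sum>i=1..n. f (w i) * ennreal (1 / real n))"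
proof -
  have "(\<integral>\<^sup>+ x. f x \<partial>empirical n w) = (\<integral>\<^sup>+ i. f (w i) \<partial>uniform_count_measure {1..n})"
    unfolding empirical_def
    by (rule nn_integral_distr) (auto simp: uniform_count_measure_def)
  also have "\<dots> = (\<Sum>i=1..n. f (w i) * ennreal (1 / real n))"
    using assms(1)
    by (simp add: uniform_count_measure_def nn_integral_point_measure_finite mult.commute)
  finally show ?thesis .
qed

lemma integral_empirical:
  fixes f :: "'a::topological_space \<Rightarrow> real"
  assumes "1 \<le> n" and [measurable]: "f \<in> borel_measurable borel"
  shows "integrable (empirical n w) f" "(\<integral> x. f x \<partial>empirical n w) = 1 / real n * (\<Sum>i=1..n. f (w i))"
proof -
  have w: "w \<in> uniform_count_measure {1..n} \<rightarrow>\<^sub>M borel" by (auto simp: uniform_count_measure_def)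
  have "integrable (uniform_count_measure {1..n}) (\<lambda>i. f (w i))"
    unfolding uniform_count_measure_def by (rule integrable_point_measure_finite) auto
  then show "integrable (empirical n w) f"
    unfolding empirical_def integrable_distr_eq[OF w assms(2)] .
  have "(\<integral> x. f x \<partial>empirical n w) = (\<integral> i. f (w i) \<partial>uniform_count_measure {1..n})"
    unfolding empirical_def by (rule integral_distr[OF w assms(2)])
  also have "\<dots> = 1 / real n * (\<Sum>i=1..n. f (w i))"
    using assms(1) unfolding uniform_count_measure_def
    by (subst lebesgue_integral_point_measure_finite) (auto simp: sum_distrib_left)
  finally show "(\<integral> x. f x \<partial>empirical n w) = 1 / real n * (\<Sum>i=1..n. f (w i))" .
qed

lemma prob_space_empirical:
  assumes "1 \<le> n"
  shows "prob_space (empirical n w)"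
proof
  have "emeasure (empirical n w) UNIV = 1"
    using assms by (subst emeasure_empirical) (auto simp: sum.If_cases)
  then show "emeasure (empirical n w) (space (empirical n w)) = 1" by simp
qed

lemma sets_gaussian [simp, measurable_cong]: "sets (gaussian m \<Sigma>) = sets borel"
  by (simp add: gaussian_def)

lemma sigma_finite_gaussian: "sigma_finite_measure (gaussian m \<Sigma>)"
  unfolding gaussian_def
  by (subst sigma_finite_measure.sigma_finite_iff_density_finite[OF sigma_finite_lborel]) auto

text \<open>Expansion of the squared norm of \<open>2 *\<^sub>R x - y\<close>. It converts between
  finite transport cost and finite second moment.\<close>

lemma norm_sq_le:
  fixes x y :: "'a::real_inner"
  shows "y \<bullet> y \<le> 2 * ((x - y) \<bullet> (x - y)) + 2 * (x \<bullet> x)"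
proof -
  have "0 \<le> (2 *\<^sub>R x - y) \<bullet> (2 *\<^sub>R x - y)" by simp
  then show ?thesis
    by (simp add: inner_diff_left inner_diff_right inner_commute algebra_simps)
qed

locale gaussian_sinkhorn = gaussian_reference m \<Sigma> \<epsilon>
  for m :: "real^'k" and \<Sigma> and \<epsilon> +
  fixes n :: nat and w :: "nat \<Rightarrow> real^'k"
  assumes n_pos: "1 \<le> n"
begin

abbreviation "\<nu> \<equiv> gaussian m \<Sigma>"
abbreviation "P \<equiv> empirical n w"
abbreviation "amb \<rho> \<equiv> sinkhorn_ball sq_dist \<epsilon> \<nu> \<rho> P"

definition avg_softmax :: "real^'k^'k \<Rightarrow> real" where
  "avg_softmax X = 1 / real n * (\<Sum>i=1..n. softmax X (w i))"

sublocale P: prob_space P by (rule prob_space_empirical[OF n_pos])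
sublocale \<nu>: sigma_finite_measure \<nu> by (rule sigma_finite_gaussian)
sublocale P\<nu>: pair_sigma_finite P \<nu> ..

section \<open>Marginals and integrability under couplings with the empirical measure\<close>

lemma borel_measurable_softmax [measurable]: "softmax X \<in> borel_measurable borel"
proof -
  have "shift \<in> borel_measurable borel" unfolding shift_def[abs_def] by measurable
  then show ?thesis unfolding softmax_def[abs_def]
    by (intro borel_measurable_add borel_measurable_diff borel_measurable_inner borel_measurable_const
        measurable_compose[OF _ borel_measurable_matrix_vector]) auto
qed

lemma borel_measurable_gibbs [measurable]:
  "(\<lambda>z. gibbs X (fst z) (snd z)) \<in> borel_measurable (borel \<Otimes>\<^sub>M borel)"
  unfolding gibbs_def by measurable

text \<open>The kernel integrates to 1 in \<open>y\<close> for each \<open>x\<close>, so tilting the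
  product measure by it keeps the first marginal. With \<open>g = 1\<close> this is the
  normalization that \<open>gibbs_inequality\<close> asks for.\<close>

lemma nn_integral_P\<nu>_gibbs:
  assumes X: "posdef (K - X)" and [measurable]: "g \<in> borel_measurable borel"
  shows "(\<integral>\<^sup>+ z. ennreal (exp (gibbs X (fst z) (snd z))) * g (fst z) \<partial>(P \<Otimes>\<^sub>M \<nu>)) = (\<integral>\<^sup>+ x. g x \<partial>P)"
proof -
  have [measurable]: "(\<lambda>y. gibbs X x y) \<in> borel_measurable borel" for x
    unfolding gibbs_def by measurable
  have "(\<integral>\<^sup>+ z. ennreal (exp (gibbs X (fst z) (snd z))) * g (fst z) \<partial>(P \<Otimes>\<^sub>M \<nu>))
      = (\<integral>\<^sup>+ x. \<integral>\<^sup>+ y. ennreal (exp (gibbs X x y)) * g x \<partial>\<nu> \<partial>P)"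
    by (subst \<nu>.nn_integral_fst[symmetric]) simp_all
  also have "\<dots> = (\<integral>\<^sup>+ x. g x \<partial>P)"
    by (intro nn_integral_cong) (simp add: nn_integral_multc nn_integral_exp_gibbs[OF X])
  finally show ?thesis .
qed

lemma coupling_marginals:
  assumes "\<gamma> \<in> couplings P Q" "sets Q = sets borel"
  shows "sets \<gamma> = sets (borel \<Otimes>\<^sub>M borel)"
    and "\<And>f :: real^'k \<Rightarrow> real. f \<in> borel_measurable borel \<Longrightarrow> integrable \<gamma> (\<lambda>z. f (fst z))"
    and "\<And>f :: real^'k \<Rightarrow> real. f \<in> borel_measurable borel \<Longrightarrow>
           (\<integral> z. f (fst z) \<partial>\<gamma>) = 1 / real n * (\<Sum>i=1..n. f (w i))"
    and "\<And>f :: real^'k \<Rightarrow> real. f \<in> borel_measurable borel \<Longrightarrow>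
           integrable Q f \<longleftrightarrow> integrable \<gamma> (\<lambda>z. f (snd z))"
    and "\<And>f :: real^'k \<Rightarrow> real. f \<in> borel_measurable borel \<Longrightarrow> (\<integral> y. f y \<partial>Q) = (\<integral> z. f (snd z) \<partial>\<gamma>)"
proof -
  have P: "distr \<gamma> P fst = P" and Q: "distr \<gamma> Q snd = Q" and "sets \<gamma> = sets (P \<Otimes>\<^sub>M Q)"
    using assms by (auto simp: couplings_def)
  then show s: "sets \<gamma> = sets (borel \<Otimes>\<^sub>M borel)"
    using sets_pair_measure_cong[of P borel Q borel] assms by simp
  have f: "fst \<in> \<gamma> \<rightarrow>\<^sub>M P" and g: "snd \<in> \<gamma> \<rightarrow>\<^sub>M Q"
    using measurable_cong_sets[OF s, of P borel] measurable_cong_sets[OF s, of Q borel] assms(2) by auto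
  fix h :: "real^'k \<Rightarrow> real" assume h: "h \<in> borel_measurable borel"
  then have hP: "h \<in> borel_measurable P" and hQ: "h \<in> borel_measurable Q"
    using measurable_cong_sets[OF assms(2) refl, of borel] by auto
  have "integrable (distr \<gamma> P fst) h" unfolding P by (rule integral_empirical[OF n_pos h])
  then show "integrable \<gamma> (\<lambda>z. h (fst z))" by (simp add: integrable_distr_eq[OF f hP])
  have "(\<integral> z. h (fst z) \<partial>\<gamma>) = (\<integral> x. h x \<partial>distr \<gamma> P fst)" by (simp add: integral_distr[OF f hP])
  then show "(\<integral> z. h (fst z) \<partial>\<gamma>) = 1 / real n * (\<Sum>i=1..n. h (w i))"
    unfolding P by (simp add: integral_empirical[OF n_pos h])
  show "integrable Q h \<longleftrightarrow> integrable \<gamma> (\<lambda>z. h (snd z))"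
    using integrable_distr_eq[OF g hQ] unfolding Q .
  show "(\<integral> y. h y \<partial>Q) = (\<integral> z. h (snd z) \<partial>\<gamma>)"
    using integral_distr[OF g hQ] unfolding Q .
qed

text \<open>Since the first marginal has finite support, finite transport cost and finite second
  moment of \<open>y\<close> are equivalent, and either controls every term of \<open>gibbs\<close>.
  The first alternative serves an arbitrary coupling of finite cost, the second the Gibbs coupling,
  whose second moment is estimated directly.\<close>

lemma integrable_coupling:
  assumes \<gamma>: "\<gamma> \<in> couplings P Q" "sets Q = sets borel"
    and int: "integrable \<gamma> (\<lambda>z. (fst z - snd z) \<bullet> (fst z - snd z)) \<or> integrable \<gamma> (\<lambda>z. snd z \<bullet> snd z)"
  shows "integrable \<gamma> (\<lambda>z. (fst z - snd z) \<bullet> (fst z - snd z))" "integrable \<gamma> (\<lambda>z. snd z \<bullet> (X *v snd z))"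
    "integrable \<gamma> (\<lambda>z. gibbs X (fst z) (snd z))"
    "(\<integral> z. gibbs X (fst z) (snd z) \<partial>\<gamma>) = ((\<integral> z. snd z \<bullet> (X *v snd z) \<partial>\<gamma>)
       - (\<integral> z. (fst z - snd z) \<bullet> (fst z - snd z) \<partial>\<gamma>) - avg_softmax X) / \<epsilon>"
proof -
  note s = coupling_marginals(1)[OF \<gamma>]
  note [measurable_cong] = s
  have xx: "integrable \<gamma> (\<lambda>z. fst z \<bullet> fst z)" by (rule coupling_marginals(2)[OF \<gamma>]) measurable
  have yy: "integrable \<gamma> (\<lambda>z. snd z \<bullet> snd z)"
    using int
  proof
    assume "integrable \<gamma> (\<lambda>z. (fst z - snd z) \<bullet> (fst z - snd z))"
    then have "integrable \<gamma> (\<lambda>z. 2 * ((fst z - snd z) \<bullet> (fst z - snd z)) + 2 * (fst z \<bullet> fst z))"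
      using xx by auto
    then show ?thesis
    proof (rule Bochner_Integration.integrable_bound)
      show "AE z in \<gamma>. norm (snd z \<bullet> snd z) \<le> norm (2 * ((fst z - snd z) \<bullet> (fst z - snd z)) + 2 * (fst z \<bullet> fst z))"
        by (rule AE_I2) (smt (verit) norm_sq_le inner_ge_zero real_norm_def)
    qed measurable
  qed
  show cc: "integrable \<gamma> (\<lambda>z. (fst z - snd z) \<bullet> (fst z - snd z))"
  proof (rule Bochner_Integration.integrable_bound)
    show "integrable \<gamma> (\<lambda>z. 2 * (snd z \<bullet> snd z) + 2 * (fst z \<bullet> fst z))" using xx yy by auto
    show "AE z in \<gamma>. norm ((fst z - snd z) \<bullet> (fst z - snd z)) \<le> norm (2 * (snd z \<bullet> snd z) + 2 * (fst z \<bullet> fst z))"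
    proof (rule AE_I2)
      fix z :: "(real^'k) \<times> (real^'k)"
      have "(fst z - snd z) \<bullet> (fst z - snd z) \<le> 2 * (snd z \<bullet> snd z) + 2 * (fst z \<bullet> fst z)"
        using norm_sq_le[of "fst z - snd z" "fst z"] by simp
      then show "norm ((fst z - snd z) \<bullet> (fst z - snd z)) \<le> norm (2 * (snd z \<bullet> snd z) + 2 * (fst z \<bullet> fst z))"
        by (smt (verit) inner_ge_zero real_norm_def)
    qed
  qed measurable
  obtain k where k: "0 < k" "\<And>x. \<bar>x \<bullet> (X *v x)\<bar> \<le> k * (x \<bullet> x)" using quadratic_bound by blast
  show qq: "integrable \<gamma> (\<lambda>z. snd z \<bullet> (X *v snd z))"
  proof (rule Bochner_Integration.integrable_bound)
    show "integrable \<gamma> (\<lambda>z. k * (snd z \<bullet> snd z))" using yy by auto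
    show "AE z in \<gamma>. norm (snd z \<bullet> (X *v snd z)) \<le> norm (k * (snd z \<bullet> snd z))"
      using k by (intro AE_I2) auto
  qed measurable
  have sm: "integrable \<gamma> (\<lambda>z. softmax X (fst z))" by (rule coupling_marginals(2)[OF \<gamma>]) measurable
  show "integrable \<gamma> (\<lambda>z. gibbs X (fst z) (snd z))"
    unfolding gibbs_def using qq cc sm by auto
  have "(\<integral> z. softmax X (fst z) \<partial>\<gamma>) = avg_softmax X"
    unfolding avg_softmax_def by (rule coupling_marginals(3)[OF \<gamma>]) measurable
  then show "(\<integral> z. gibbs X (fst z) (snd z) \<partial>\<gamma>) = ((\<integral> z. snd z \<bullet> (X *v snd z) \<partial>\<gamma>)
       - (\<integral> z. (fst z - snd z) \<bullet> (fst z - snd z) \<partial>\<gamma>) - avg_softmax X) / \<epsilon>"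
    unfolding gibbs_def using qq cc sm by simp
qed

section \<open>Weak duality and its attainment by Gibbs measures\<close>

lemma sq_dist_eq: "sq_dist x y = ennreal ((x - y) \<bullet> (x - y))"
  by (simp add: sq_dist_def power2_norm_eq_inner)

text \<open>\<open>gibbs_inequality\<close> applied to the log-density \<open>gibbs X\<close> and
  multiplied by \<epsilon> bounds the expectation of \<open>y \<bullet> (X *v y)\<close> by
  transport cost plus \<epsilon> times entropy plus \<open>avg_softmax X\<close>. The bound by a
  real \<open>r\<close> forces both cost and entropy to be finite.\<close>

lemma coupling_weak_duality:
  assumes \<gamma>: "\<gamma> \<in> couplings P Q" "sets Q = sets borel" and X: "posdef (K - X)"
    and less: "enn2ereal (\<integral>\<^sup>+ z. sq_dist (fst z) (snd z) \<partial>\<gamma>) + ereal \<epsilon> * rel_entropy \<gamma> (P \<Otimes>\<^sub>M \<nu>) < ereal r"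
  shows "integrable Q (\<lambda>y. y \<bullet> (X *v y)) \<and> (\<integral> y. y \<bullet> (X *v y) \<partial>Q) < r + avg_softmax X"
proof -
  note s = coupling_marginals(1)[OF \<gamma>]
  note [measurable_cong] = s
  let ?c = "\<lambda>z :: (real^'k) \<times> (real^'k). (fst z - snd z) \<bullet> (fst z - snd z)"
  have sets: "sets \<gamma> = sets (P \<Otimes>\<^sub>M \<nu>)"
    using s sets_pair_measure_cong[of P borel \<nu> borel] by simp
  have pos: "0 \<le> enn2ereal (\<integral>\<^sup>+ z. sq_dist (fst z) (snd z) \<partial>\<gamma>)" by simp
  have fin: "absolutely_continuous (P \<Otimes>\<^sub>M \<nu>) \<gamma>"
    "integrable \<gamma> (entropy_density (exp 1) (P \<Otimes>\<^sub>M \<nu>) \<gamma>)"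
  proof -
    have "rel_entropy \<gamma> (P \<Otimes>\<^sub>M \<nu>) \<noteq> \<infinity>"
      using less eps_pos pos by (auto simp: ereal_mult_eq_PInfty)
    then show "absolutely_continuous (P \<Otimes>\<^sub>M \<nu>) \<gamma>"
      "integrable \<gamma> (entropy_density (exp 1) (P \<Otimes>\<^sub>M \<nu>) \<gamma>)"
      by (auto simp: rel_entropy_def split: if_splits)
  qed
  define H where "H = KL_divergence (exp 1) (P \<Otimes>\<^sub>M \<nu>) \<gamma>"
  have H: "rel_entropy \<gamma> (P \<Otimes>\<^sub>M \<nu>) = ereal H" using fin by (simp add: rel_entropy_def H_def)
  let ?I = "\<integral>\<^sup>+ z. ennreal (?c z) \<partial>\<gamma>"
  have I: "enn2ereal ?I + ereal (\<epsilon> * H) < ereal r" using less by (simp add: H sq_dist_eq)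
  then have "?I \<noteq> \<infinity>" by auto
  then have int: "integrable \<gamma> ?c"
    by (intro integrableI_nonneg) (auto simp: less_top)
  note ic = integrable_coupling[OF \<gamma> disjI1[OF int]]
  have "?I = ennreal (\<integral> z. ?c z \<partial>\<gamma>)" using int by (intro nn_integral_eq_integral) auto
  then have val: "(\<integral> z. ?c z \<partial>\<gamma>) + \<epsilon> * H < r" using I by (simp add: enn2ereal_ennreal)
  have "(\<integral> z. gibbs X (fst z) (snd z) \<partial>\<gamma>) \<le> H"
    unfolding H_def
  proof (rule gibbs_inequality)
    show "sigma_finite_measure (P \<Otimes>\<^sub>M \<nu>)" by (rule P\<nu>.sigma_finite_measure_axioms)
    show "prob_space \<gamma>" using \<gamma> by (simp add: couplings_def)
    show "(\<integral>\<^sup>+ z. ennreal (exp (gibbs X (fst z) (snd z))) \<partial>(P \<Otimes>\<^sub>M \<nu>)) \<le> 1"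
      using nn_integral_P\<nu>_gibbs[OF X, of "\<lambda>_. 1"] by (simp add: P.emeasure_space_1[simplified])
  qed (use sets fin ic in auto)
  then have "(\<integral> z. snd z \<bullet> (X *v snd z) \<partial>\<gamma>) - (\<integral> z. ?c z \<partial>\<gamma>) - avg_softmax X \<le> \<epsilon> * H"
    using eps_pos ic(4)[of X] by (simp add: field_simps)
  then have "(\<integral> z. snd z \<bullet> (X *v snd z) \<partial>\<gamma>) < r + avg_softmax X" using val by simp
  then show ?thesis
    using ic(2) coupling_marginals(4,5)[OF \<gamma>, of "\<lambda>y. y \<bullet> (X *v y)"] by simp
qed

text \<open>The infimum over couplings is approached rather than assumed attained: a coupling of
  value below \<open>\<rho> + \<delta>\<close> exists for every positive \<delta>, and \<delta> then
  tends to 0.\<close>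

lemma weak_duality:
  assumes Q: "Q \<in> amb \<rho>" and X: "posdef (K - X)"
  shows "integrable Q (\<lambda>y. y \<bullet> (X *v y))" "(\<integral> y. y \<bullet> (X *v y) \<partial>Q) \<le> \<rho> + avg_softmax X"
proof -
  have sets: "sets Q = sets borel" and le: "sinkhorn sq_dist \<epsilon> \<nu> P Q \<le> ereal \<rho>"
    using Q by (auto simp: sinkhorn_ball_def)
  have *: "integrable Q (\<lambda>y. y \<bullet> (X *v y)) \<and> (\<integral> y. y \<bullet> (X *v y) \<partial>Q) < \<rho> + \<delta> + avg_softmax X"
    if "0 < \<delta>" for \<delta>
  proof -
    have "sinkhorn sq_dist \<epsilon> \<nu> P Q < ereal (\<rho> + \<delta>)"
      using le that by (rule_tac le_less_trans) auto
    then obtain \<gamma> where "\<gamma> \<in> couplings P Q"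
      "enn2ereal (\<integral>\<^sup>+ z. sq_dist (fst z) (snd z) \<partial>\<gamma>) + ereal \<epsilon> * rel_entropy \<gamma> (P \<Otimes>\<^sub>M \<nu>) < ereal (\<rho> + \<delta>)"
      unfolding sinkhorn_def by (auto simp: INF_less_iff)
    then show ?thesis using coupling_weak_duality sets X by blast
  qed
  show "integrable Q (\<lambda>y. y \<bullet> (X *v y))" using *[of 1] by simp
  show "(\<integral> y. y \<bullet> (X *v y) \<partial>Q) \<le> \<rho> + avg_softmax X"
  proof (rule field_le_epsilon)
    fix e :: real assume "0 < e"
    from *[OF this] show "(\<integral> y. y \<bullet> (X *v y) \<partial>Q) \<le> \<rho> + avg_softmax X + e" by simp
  qed
qed

text \<open>The coupling with density \<open>exp (gibbs X x y)\<close> has as entropy the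
  expectation of \<open>gibbs X\<close> itself. Adding \<epsilon> times this to the transport cost
  cancels the cost and leaves exactly the stated radius.\<close>

lemma gibbs_measure_attains:
  assumes X: "posdef (K - X)"
  shows "\<exists>Q. Q \<in> amb ((\<integral> y. y \<bullet> (X *v y) \<partial>Q) - avg_softmax X)"
proof -
  define \<mu> where "\<mu> = P \<Otimes>\<^sub>M \<nu>"
  have s\<mu>[measurable_cong]: "sets \<mu> = sets (borel \<Otimes>\<^sub>M borel)"
    using sets_pair_measure_cong[of P borel \<nu> borel] by (simp add: \<mu>_def)
  let ?g = "\<lambda>z. gibbs X (fst z) (snd z)"
  have [measurable]: "(\<lambda>y. gibbs Y x y) \<in> borel_measurable borel" for x Y
    unfolding gibbs_def by measurable
  define \<gamma> where "\<gamma> = density \<mu> (\<lambda>z. ennreal (exp (?g z)))"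
  have s\<gamma>[measurable_cong]: "sets \<gamma> = sets (borel \<Otimes>\<^sub>M borel)" by (simp add: \<gamma>_def s\<mu>)
  have nn: "(\<integral>\<^sup>+ z. f z \<partial>\<gamma>) = (\<integral>\<^sup>+ z. ennreal (exp (?g z)) * f z \<partial>\<mu>)"
    if "f \<in> borel_measurable (borel \<Otimes>\<^sub>M borel)" for f
    unfolding \<gamma>_def using that by (intro nn_integral_density) auto
  have marg: "(\<integral>\<^sup>+ z. f (fst z) \<partial>\<gamma>) = (\<integral>\<^sup>+ x. f x \<partial>P)" if [measurable]: "f \<in> borel_measurable borel" for f
    using nn_integral_P\<nu>_gibbs[OF X that] by (subst nn) (auto simp: \<mu>_def)
  define Q where "Q = distr \<gamma> borel snd"
  have sQ: "sets Q = sets borel" by (simp add: Q_def)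
  have prob: "prob_space \<gamma>"
  proof
    show "emeasure \<gamma> (space \<gamma>) = 1"
      using marg[of "\<lambda>_. 1"] by (simp add: P.emeasure_space_1[simplified])
  qed
  have coup: "\<gamma> \<in> couplings P Q"
    unfolding couplings_def
  proof (safe intro!: prob)
    have sPQ: "sets \<gamma> = sets (P \<Otimes>\<^sub>M Q)"
      using s\<gamma> sets_pair_measure_cong[of P borel Q borel] sQ by simp
    then show "x \<in> sets (P \<Otimes>\<^sub>M Q)" if "x \<in> sets \<gamma>" for x using that by simp
    show "x \<in> sets \<gamma>" if "x \<in> sets (P \<Otimes>\<^sub>M Q)" for x using that sPQ by simp
    show "distr \<gamma> P fst = P"
    proof (rule measure_eqI)
      fix A assume "A \<in> sets (distr \<gamma> P fst)"
      then have A[measurable]: "A \<in> sets borel" by simp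
      have "emeasure (distr \<gamma> P fst) A = (\<integral>\<^sup>+ x. indicator A x \<partial>distr \<gamma> P fst)" using A by simp
      also have "\<dots> = (\<integral>\<^sup>+ z. indicator A (fst z) \<partial>\<gamma>)" by (rule nn_integral_distr) measurable
      also have "\<dots> = emeasure P A" by (subst marg) simp_all
      finally show "emeasure (distr \<gamma> P fst) A = emeasure P A" .
    qed simp
    show "distr \<gamma> Q snd = Q" unfolding Q_def by (rule distr_cong) simp_all
  qed
  \<comment> \<open>There is room to enlarge \<open>X\<close> to
    \<open>X' = X + \<delta> *\<^sub>R mat 1\<close>. The factor \<open>y \<bullet> y\<close> is at
    most \<epsilon>/\<delta> times the exponential of
    \<open>\<delta> / \<epsilon> * (y \<bullet> y)\<close>, which turns the kernel of
    \<open>X\<close> into that of \<open>X'\<close> up to a factor depending on \<open>x\<close>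
    alone.\<close>
  have yy: "integrable \<gamma> (\<lambda>z. snd z \<bullet> snd z)"
  proof (rule integrableI_nonneg)
    obtain d where d: "0 < d" "\<And>t. \<bar>t\<bar> < d \<Longrightarrow> posdef (K - X - t *\<^sub>R mat 1)"
      using posdef_perturb[OF X, of "mat 1"] by auto
    define \<delta> where "\<delta> = d / 2"
    define X' where "X' = X + \<delta> *\<^sub>R mat 1"
    have \<delta>: "0 < \<delta>" using d by (simp add: \<delta>_def)
    have "posdef (K - X - \<delta> *\<^sub>R mat 1)" using d by (simp add: \<delta>_def)
    then have X': "posdef (K - X')" by (simp add: X'_def diff_diff_eq)
    let ?h = "\<lambda>x. ennreal (\<epsilon> / \<delta> * exp ((softmax X' x - softmax X x) / \<epsilon>))"
    have gb: "y \<bullet> y * exp (gibbs X x y) \<le> exp (gibbs X' x y) * (\<epsilon> / \<delta> * exp ((softmax X' x - softmax X x) / \<epsilon>))" for x y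
    proof -
      have e: "gibbs X' x y + (softmax X' x - softmax X x) / \<epsilon> = gibbs X x y + \<delta> / \<epsilon> * (y \<bullet> y)"
        using eps_pos by (simp add: gibbs_def X'_def matrix_vector_mult_add_rdistrib inner_add_right
            field_simps flip: scaleR_matrix_vector_assoc)
      have "\<delta> / \<epsilon> * (y \<bullet> y) \<le> exp (\<delta> / \<epsilon> * (y \<bullet> y))" using exp_ge_add_one_self[of "\<delta> / \<epsilon> * (y \<bullet> y)"] by linarith
      then have "\<delta> / \<epsilon> * (y \<bullet> y) * exp (gibbs X x y) \<le> exp (\<delta> / \<epsilon> * (y \<bullet> y)) * exp (gibbs X x y)"
        by (rule mult_right_mono) simp
      also have "\<dots> = exp (gibbs X' x y) * exp ((softmax X' x - softmax X x) / \<epsilon>)"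
        unfolding exp_add[symmetric] e by (simp add: add.commute)
      finally show ?thesis using \<delta> eps_pos by (simp add: field_simps)
    qed
    have "(\<integral>\<^sup>+ z. ennreal (snd z \<bullet> snd z) \<partial>\<gamma>)
        = (\<integral>\<^sup>+ z. ennreal (exp (?g z)) * ennreal (snd z \<bullet> snd z) \<partial>\<mu>)"
      by (rule nn) measurable
    also have "\<dots> \<le> (\<integral>\<^sup>+ z. ennreal (exp (gibbs X' (fst z) (snd z))) * ?h (fst z) \<partial>\<mu>)"
      using gb \<delta> eps_pos
      by (intro nn_integral_mono) (simp add: ennreal_mult[symmetric] mult.commute)
    also have "\<dots> = (\<integral>\<^sup>+ x. ?h x \<partial>P)"
      unfolding \<mu>_def by (rule nn_integral_P\<nu>_gibbs[OF X']) measurable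
    also have "\<dots> < \<infinity>"
      by (subst nn_integral_empirical[OF n_pos]) (auto simp: ennreal_mult_less_top)
    finally show "(\<integral>\<^sup>+ z. ennreal (snd z \<bullet> snd z) \<partial>\<gamma>) < \<infinity>" .
  qed auto
  note ic = integrable_coupling[OF coup sQ disjI2[OF yy]]
  have ac: "absolutely_continuous \<mu> \<gamma>"
    unfolding \<gamma>_def by (rule absolutely_continuousI_density) measurable
  interpret \<mu>: sigma_finite_measure \<mu>
    unfolding \<mu>_def by (rule P\<nu>.sigma_finite_measure_axioms)
  \<comment> \<open>Uniqueness of the Radon-Nikodym derivative identifies the entropy density with
    \<open>gibbs X\<close> almost everywhere.\<close>
  have "AE z in \<mu>. ennreal (exp (?g z)) = RN_deriv \<mu> \<gamma> z"
    by (rule \<mu>.RN_deriv_unique) (simp_all add: \<gamma>_def)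
  from absolutely_continuous_AE[OF _ ac this]
  have "AE z in \<gamma>. ennreal (exp (?g z)) = RN_deriv \<mu> \<gamma> z" by (simp add: \<gamma>_def)
  then have ed: "AE z in \<gamma>. entropy_density (exp 1) \<mu> \<gamma> z = ?g z"
  proof eventually_elim
    case (elim z)
    show ?case by (simp add: entropy_density_def log_def elim[symmetric])
  qed
  have edm: "entropy_density (exp 1) \<mu> \<gamma> \<in> borel_measurable \<gamma>"
    using measurable_entropy_density[of "exp 1" \<mu> \<gamma>] measurable_cong_sets[of \<gamma> \<mu>] s\<gamma> s\<mu> by auto
  have int: "integrable \<gamma> (entropy_density (exp 1) \<mu> \<gamma>)"
    using ic(3) ed by (subst integrable_cong_AE[OF edm _ ed]) auto
  have "KL_divergence (exp 1) \<mu> \<gamma> = (\<integral> z. ?g z \<partial>\<gamma>)"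
    unfolding KL_divergence_def using ed edm ic(3) by (intro integral_cong_AE) auto
  then have rel: "rel_entropy \<gamma> \<mu> = ereal (\<integral> z. ?g z \<partial>\<gamma>)"
    using ac int by (simp add: rel_entropy_def)
  have "(\<integral>\<^sup>+ z. sq_dist (fst z) (snd z) \<partial>\<gamma>) = ennreal (\<integral> z. (fst z - snd z) \<bullet> (fst z - snd z) \<partial>\<gamma>)"
    unfolding sq_dist_eq using ic(1) by (intro nn_integral_eq_integral) auto
  then have cost: "enn2ereal (\<integral>\<^sup>+ z. sq_dist (fst z) (snd z) \<partial>\<gamma>) + ereal \<epsilon> * rel_entropy \<gamma> \<mu>
      = ereal ((\<integral> z. (fst z - snd z) \<bullet> (fst z - snd z) \<partial>\<gamma>) + \<epsilon> * (\<integral> z. ?g z \<partial>\<gamma>))"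
    by (simp add: rel enn2ereal_ennreal)
  have "(\<integral> z. (fst z - snd z) \<bullet> (fst z - snd z) \<partial>\<gamma>) + \<epsilon> * (\<integral> z. ?g z \<partial>\<gamma>)
      = (\<integral> y. y \<bullet> (X *v y) \<partial>Q) - avg_softmax X"
    using eps_pos coupling_marginals(5)[OF coup sQ, of "\<lambda>y. y \<bullet> (X *v y)"] by (simp add: ic(4))
  note cost[unfolded this]
  moreover have "sinkhorn sq_dist \<epsilon> \<nu> P Q
      \<le> enn2ereal (\<integral>\<^sup>+ z. sq_dist (fst z) (snd z) \<partial>\<gamma>) + ereal \<epsilon> * rel_entropy \<gamma> \<mu>"
    unfolding sinkhorn_def \<mu>_def by (rule INF_lower[OF coup])
  ultimately have "sinkhorn sq_dist \<epsilon> \<nu> P Q \<le> ereal ((\<integral> y. y \<bullet> (X *v y) \<partial>Q) - avg_softmax X)"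
    by simp
  moreover have "prob_space Q"
    unfolding Q_def using prob by (rule prob_space.prob_space_distr) measurable
  ultimately show ?thesis using sQ by (intro exI[of _ Q]) (simp add: sinkhorn_ball_def)
qed

end

section \<open>Strong duality\<close>

text \<open>Near both ends \<open>h\<close> exceeds its value at the midpoint \<open>c\<close>, so a
  minimum over a compact subinterval that contains \<open>c\<close> and reaches into both end
  regions is global.\<close>

lemma interior_minimum:
  fixes h :: "real \<Rightarrow> real"
  assumes lu: "l < u" and cont: "continuous_on {l<..<u} h"
    and lim: "filterlim h at_top (at_right l)" "filterlim h at_top (at_left u)"
  obtains x where "l < x" "x < u" "\<And>y. l < y \<Longrightarrow> y < u \<Longrightarrow> h x \<le> h y"
proof -
  define c where "c = (l + u) / 2"
  have c: "l < c" "c < u" using lu by (auto simp: c_def)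
  have "eventually (\<lambda>x. h c < h x) (at_right l)" "eventually (\<lambda>x. h c < h x) (at_left u)"
    using lim by (auto simp: filterlim_at_top_dense)
  then obtain a b where a: "l < a" "\<And>x. l < x \<Longrightarrow> x < a \<Longrightarrow> h c < h x"
    and b: "b < u" "\<And>x. b < x \<Longrightarrow> x < u \<Longrightarrow> h c < h x"
    unfolding eventually_at_right_field eventually_at_left_field by metis
  define a' where "a' = (l + min a c) / 2"
  define b' where "b' = (max b c + u) / 2"
  have a': "l < a'" "a' < a" "a' < c" using a c by (auto simp: a'_def min_def)
  have b': "b < b'" "b' < u" "c < b'" using b c by (auto simp: b'_def max_def)
  have "continuous_on {a'..b'} h"
    by (rule continuous_on_subset[OF cont]) (use a' b' in auto)
  moreover have "{a'..b'} \<noteq> {}" using a' b' by simp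
  ultimately obtain x where x: "x \<in> {a'..b'}" "\<And>y. y \<in> {a'..b'} \<Longrightarrow> h x \<le> h y"
    using continuous_attains_inf[of "{a'..b'}" h] by auto
  have "h x \<le> h c" using x(2)[of c] a' b' by simp
  have "h x \<le> h y" if "l < y" "y < u" for y
  proof (cases "y \<in> {a'..b'}")
    case False
    then have "h c < h y" using a(2)[of y] b(2)[of y] a' b' that by auto
    then show ?thesis using \<open>h x \<le> h c\<close> by simp
  qed (use x in auto)
  then show thesis using that[of x] x a' b' by simp
qed

lemma psd_nonzero_direction:
  assumes "psd (C :: real^'n^'n)" "C \<noteq> 0"
  obtains x where "0 < x \<bullet> (C *v x)"
proof -
  have "\<exists>x. x \<bullet> (C *v x) \<noteq> 0"
  proof (rule ccontr)
    assume "\<not> ?thesis"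
    then have "C *v x = 0" for x
      using assms(1) by (intro psd_null_vector[of C UNIV]) (auto simp: psd_def)
    then have "C = 0" by (intro matrix_eqI_vector) simp
    then show False using assms by simp
  qed
  then show thesis using that assms(1) unfolding psd_def by (metis order_le_less)
qed

text \<open>The threshold is \<open>1 / \<mu>\<close>, with \<mu> the largest generalized Rayleigh
  quotient of \<open>C\<close> relative to \<open>K\<close>. There the form of the pencil is still
  nonnegative and vanishes at the maximizer \<open>v\<close>, which is thus a null vector.\<close>

lemma posdef_pencil_threshold:
  fixes K C :: "real^'n^'n"
  assumes K: "posdef K" and C: "psd C" "C \<noteq> 0"
  obtains t\<^sub>0 where "0 < t\<^sub>0" "\<And>t. 0 \<le> t \<Longrightarrow> t < t\<^sub>0 \<Longrightarrow> posdef (K - t *\<^sub>R C)" "det (K - t\<^sub>0 *\<^sub>R C) = 0"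
proof -
  have pos: "0 < x \<bullet> (K *v x)" if "x \<noteq> 0" for x using K that by (simp add: posdef_def)
  let ?\<phi> = "\<lambda>x. (x \<bullet> (C *v x)) / (x \<bullet> (K *v x))"
  let ?S = "sphere 0 1 :: (real^'n) set"
  have "?S \<noteq> {}" by simp
  moreover have "continuous_on ?S ?\<phi>"
  proof (intro continuous_intros continuous_on_quadratic ballI)
    fix x assume "x \<in> ?S"
    then have "x \<noteq> 0" by auto
    then show "x \<bullet> (K *v x) \<noteq> 0" using pos by force
  qed
  ultimately obtain v where v: "norm v = 1" and max: "\<And>x. norm x = 1 \<Longrightarrow> ?\<phi> x \<le> ?\<phi> v"
    using continuous_attains_sup[of ?S ?\<phi>] by auto
  define \<mu> where "\<mu> = ?\<phi> v"
  have bound: "x \<bullet> (C *v x) \<le> \<mu> * (x \<bullet> (K *v x))" for x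
  proof (cases "x = 0")
    case False
    have "?\<phi> (x /\<^sub>R norm x) \<le> \<mu>" unfolding \<mu>_def by (rule max) (use False in simp)
    also have "?\<phi> (x /\<^sub>R norm x) = ?\<phi> x" using False by (simp add: matrix_vector_mult_scaleR)
    finally show ?thesis using pos[OF False] by (simp add: field_simps)
  qed simp
  have "v \<noteq> 0" using v by auto
  obtain x where x: "0 < x \<bullet> (C *v x)" using psd_nonzero_direction[OF C] .
  then have "x \<noteq> 0" by auto
  have "0 < \<mu> * (x \<bullet> (K *v x))" using bound[of x] x by linarith
  then have \<mu>: "0 < \<mu>" using pos[OF \<open>x \<noteq> 0\<close>] by (simp add: zero_less_mult_iff)
  have sym: "transpose (K - t *\<^sub>R C) = K - t *\<^sub>R C" for t
    using K C by (simp add: transpose_diff transpose_scaleR posdef_def psd_def)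
  have quad: "x \<bullet> ((K - t *\<^sub>R C) *v x) = x \<bullet> (K *v x) - t * (x \<bullet> (C *v x))" for x t
    by (simp add: matrix_vector_mult_diff_rdistrib inner_diff_right flip: scaleR_matrix_vector_assoc)
  show thesis
  proof
    show "0 < 1 / \<mu>" using \<mu> by simp
    show "posdef (K - t *\<^sub>R C)" if "0 \<le> t" "t < 1 / \<mu>" for t
      unfolding posdef_def
    proof (intro conjI sym allI impI)
      fix x :: "real^'n" assume "x \<noteq> 0"
      have "t * (x \<bullet> (C *v x)) \<le> t * (\<mu> * (x \<bullet> (K *v x)))" using bound that by (intro mult_left_mono)
      also have "\<dots> = (t * \<mu>) * (x \<bullet> (K *v x))" by simp
      also have "\<dots> < 1 * (x \<bullet> (K *v x))"
        using that \<mu> pos[OF \<open>x \<noteq> 0\<close>] by (intro mult_strict_right_mono) (simp_all add: field_simps)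
      finally show "0 < x \<bullet> ((K - t *\<^sub>R C) *v x)" by (simp add: quad)
    qed
    have "(K - (1 / \<mu>) *\<^sub>R C) *v v = 0"
    proof (rule psd_null_vector[OF sym, of UNIV])
      show "v \<bullet> ((K - (1 / \<mu>) *\<^sub>R C) *v v) = 0"
      proof -
        have "v \<bullet> (C *v v) = \<mu> * (v \<bullet> (K *v v))"
          using pos[OF \<open>v \<noteq> 0\<close>] by (simp add: \<mu>_def)
        then show ?thesis using \<mu> by (simp add: quad)
      qed
      show "0 \<le> x \<bullet> ((K - (1 / \<mu>) *\<^sub>R C) *v x)" for x
        using bound[of x] \<mu> unfolding quad by (simp add: field_simps)
    qed auto
    then show "det (K - (1 / \<mu>) *\<^sub>R C) = 0"
      using \<open>v \<noteq> 0\<close> inj_matrix_vector_mult[of "K - (1 / \<mu>) *\<^sub>R C"]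
      by (metis injD invertible_det_nz matrix_vector_mult_0_right)
  qed
qed

context gaussian_sinkhorn
begin

section \<open>The soft maximum along the ray of multiples of the cost matrix\<close>

lemma amb_mono: "Q \<in> amb \<rho> \<Longrightarrow> \<rho> \<le> \<rho>' \<Longrightarrow> Q \<in> amb \<rho>'"
  by (auto simp: sinkhorn_ball_def intro: order_trans)

text \<open>Only the existence of the derivative is read off the closed form;
  \<open>avg_softmax_derivative\<close> finds its value from weak duality.\<close>

lemma differentiable_avg_softmax:
  assumes "posdef (K - t *\<^sub>R C)"
  shows "(\<lambda>t. avg_softmax (t *\<^sub>R C)) differentiable (at t)"
proof -
  have entries: "(\<lambda>t. (K - t *\<^sub>R C) $ i $ j) differentiable (at t)" for i j
    by simp
  have pos: "0 < det (K - t *\<^sub>R C)" by (rule posdef_det_pos[OF assms])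
  obtain D where D: "((\<lambda>t. det (K - t *\<^sub>R C)) has_real_derivative D) (at t)"
    using differentiable_det[OF entries] by (auto simp: real_differentiable_def)
  have "((\<lambda>t. ln (det (K - t *\<^sub>R C))) has_real_derivative 1 / det (K - t *\<^sub>R C) * D) (at t)"
    by (rule DERIV_chain2[OF _ D]) (rule DERIV_ln_divide[OF pos])
  then have "(\<lambda>t. ln (det (K - t *\<^sub>R C))) differentiable (at t)"
    by (auto simp: real_differentiable_def)
  moreover have "(\<lambda>t. b \<bullet> (matrix_inv (K - t *\<^sub>R C) *v b)) differentiable (at t)" for b
    by (rule differentiable_quadratic_matrix_inv[OF entries]) (use pos in simp)
  ultimately show ?thesis
    unfolding avg_softmax_def softmax_def
    by (intro differentiable_mult differentiable_sum differentiable_add differentiable_diff differentiable_const) auto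
qed

text \<open>By weak duality the Gibbs measure at \<open>t\<close> provides an affine minorant touching at \<open>t\<close>.\<close>

lemma avg_softmax_derivative:
  assumes C: "psd C" and t: "posdef (K - t *\<^sub>R C)"
    and Q: "Q \<in> amb ((\<integral> y. y \<bullet> ((t *\<^sub>R C) *v y) \<partial>Q) - avg_softmax (t *\<^sub>R C))"
  shows "((\<lambda>t. avg_softmax (t *\<^sub>R C)) has_real_derivative (\<integral> y. y \<bullet> (C *v y) \<partial>Q)) (at t)"
proof -
  let ?G = "\<lambda>t. avg_softmax (t *\<^sub>R C)"
  define V where "V = (\<integral> y. y \<bullet> (C *v y) \<partial>Q)"
  have scale: "(\<integral> y. y \<bullet> ((u *\<^sub>R C) *v y) \<partial>Q) = u * V" for u
    by (simp add: V_def flip: scaleR_matrix_vector_assoc)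
  obtain D where D: "(?G has_real_derivative D) (at t)"
    using differentiable_avg_softmax[OF t] by (auto simp: real_differentiable_def)
  obtain d where d: "0 < d" "\<And>u. \<bar>u\<bar> < d \<Longrightarrow> posdef (K - t *\<^sub>R C - u *\<^sub>R C)"
    using posdef_perturb[OF t, of C] C by (auto simp: psd_def)
  have der: "((\<lambda>u. ?G u - u * V) has_real_derivative D - V) (at t)"
    by (auto intro!: derivative_eq_intros D)
  \<comment> \<open>\<open>Q\<close> has radius \<open>t * V - ?G t\<close>, so weak duality at
    \<open>u\<close> makes \<open>?G u - u * V\<close> minimal at \<open>u = t\<close>.\<close>
  have "D - V = 0"
  proof (rule DERIV_local_min[OF der d(1)], intro allI impI)
    fix u assume "\<bar>t - u\<bar> < d"
    then have "posdef (K - t *\<^sub>R C - (u - t) *\<^sub>R C)" by (intro d) simp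
    then have "posdef (K - u *\<^sub>R C)" by (simp add: algebra_simps)
    from weak_duality(2)[OF Q this] show "?G t - t * V \<le> ?G u - u * V" by (simp add: scale)
  qed
  then show ?thesis using D by (simp add: V_def)
qed

text \<open>The determinant tends to 0 from above, so its negative logarithm tends to \<infinity>.
  The inverse quadratic form is nonnegative and is dropped from the lower bound; the remaining terms
  are constant in \<open>t\<close>.\<close>

lemma avg_softmax_blow_up:
  assumes t\<^sub>0: "0 < t\<^sub>0" and pd: "\<And>t. 0 \<le> t \<Longrightarrow> t < t\<^sub>0 \<Longrightarrow> posdef (K - t *\<^sub>R C)"
    and zero: "det (K - t\<^sub>0 *\<^sub>R C) = 0"
  shows "filterlim (\<lambda>t. avg_softmax (t *\<^sub>R C)) at_top (at_left t\<^sub>0)"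
proof -
  let ?d = "\<lambda>t. det (K - t *\<^sub>R C)"
  define a where "a i = \<epsilon> * CARD('k) / 2 * ln (\<epsilon> / 2) - \<epsilon> / 2 * ln (det \<Sigma>)
     - w i \<bullet> w i - \<epsilon> / 2 * (m \<bullet> (matrix_inv \<Sigma> *v m))" for i
  define c where "c = 1 / real n * (\<Sum>i=1..n. a i)"
  have ev: "\<forall>\<^sub>F t in at_left t\<^sub>0. 0 < t \<and> t < t\<^sub>0"
    using t\<^sub>0 by (auto simp: eventually_at_left_field intro!: exI[of _ 0])
  have "isCont ?d t\<^sub>0"
    by (intro differentiable_imp_continuous_within differentiable_det) simp
  then have "(?d \<longlongrightarrow> 0) (at_left t\<^sub>0)"
    by (auto simp: isCont_def zero intro: filterlim_at_split[THEN iffD1, THEN conjunct1])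
  moreover have "\<forall>\<^sub>F t in at_left t\<^sub>0. ?d t \<in> {0<..} \<and> ?d t \<noteq> 0"
    using ev
  proof eventually_elim
    case (elim t)
    then have "0 < ?d t" by (intro posdef_det_pos pd) auto
    then show ?case by simp
  qed
  ultimately have "filterlim ?d (at_right 0) (at_left t\<^sub>0)"
    by (auto simp: filterlim_at)
  then have "filterlim (\<lambda>t. ln (?d t)) at_bot (at_left t\<^sub>0)"
    by (rule filterlim_compose[OF ln_at_0])
  then have "filterlim (\<lambda>t. c + \<epsilon> / 2 * (- ln (?d t))) at_top (at_left t\<^sub>0)"
    using eps_pos
    by (intro filterlim_tendsto_add_at_top[OF tendsto_const] filterlim_tendsto_pos_mult_at_top[OF tendsto_const])
      (auto simp: filterlim_uminus_at_top)
  then show ?thesis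
  proof (rule filterlim_at_top_mono)
    show "\<forall>\<^sub>F t in at_left t\<^sub>0. c + \<epsilon> / 2 * (- ln (?d t)) \<le> avg_softmax (t *\<^sub>R C)"
      using ev
    proof eventually_elim
      case (elim t)
      have nn: "0 \<le> shift (w i) \<bullet> (matrix_inv (K - t *\<^sub>R C) *v shift (w i))" for i
        using posdef_imp_psd[OF posdef_matrix_inv[OF pd]] elim by (auto simp: psd_def)
      have "c + \<epsilon> / 2 * (- ln (?d t)) = 1 / real n * (\<Sum>i=1..n. a i - \<epsilon> / 2 * ln (?d t))"
        using n_pos by (simp add: c_def sum_subtractf right_diff_distrib)
      also have "\<dots> \<le> avg_softmax (t *\<^sub>R C)"
        unfolding avg_softmax_def softmax_def
        by (intro mult_left_mono sum_mono) (use nn in \<open>auto simp: a_def\<close>)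
      finally show ?case .
    qed
  qed
qed

text \<open>Here \<open>t\<close> is the reciprocal of the multiplier. Stating the claim through a
  strict bound \<open>r\<close> covers the case in which the dual infimum is only approached as
  \<open>t\<close> tends to 0.\<close>

lemma strong_duality:
  assumes C: "psd C" and feas: "- avg_softmax 0 \<le> \<rho>"
    and bound: "\<And>Q. Q \<in> amb \<rho> \<Longrightarrow> (\<integral> y. y \<bullet> (C *v y) \<partial>Q) < r"
  shows "\<exists>t>0. posdef (K - t *\<^sub>R C) \<and> (\<rho> + avg_softmax (t *\<^sub>R C)) / t < r"
proof -
  let ?G = "\<lambda>t. avg_softmax (t *\<^sub>R C)"
  have K0: "posdef (K - 0 *\<^sub>R C)" using posdef_K by simp
  obtain Q\<^sub>0 where Q\<^sub>0: "Q\<^sub>0 \<in> amb ((\<integral> y. y \<bullet> ((0 *\<^sub>R C) *v y) \<partial>Q\<^sub>0) - ?G 0)"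
    using gibbs_measure_attains[OF K0] by blast
  then have "Q\<^sub>0 \<in> amb \<rho>" using feas by (auto intro: amb_mono)
  note r0 = bound[OF this]
  note der0 = avg_softmax_derivative[OF C K0 Q\<^sub>0]
  obtain d where d: "0 < d" "\<And>t. \<bar>t\<bar> < d \<Longrightarrow> posdef (K - t *\<^sub>R C)"
    using posdef_perturb[OF posdef_K, of C] C by (auto simp: psd_def)
  consider "C = 0" | "C \<noteq> 0" "- avg_softmax 0 = \<rho>" | "C \<noteq> 0" "- avg_softmax 0 < \<rho>" using feas by linarith
  then show ?thesis
  proof cases
    case 1
    \<comment> \<open>For \<open>C = 0\<close> the objective is a constant over \<open>t\<close>,
      and \<open>r\<close> is positive. With \<open>a = \<rho> + avg_softmax 0\<close>, this
      \<open>t\<close> gives the value \<open>a * r / (a + r) < r\<close>.\<close>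
    define t where "t = (\<rho> + avg_softmax 0) / r + 1"
    have r: "0 < r" using r0 1 by simp
    then have t: "0 < t" using feas by (simp add: t_def add_nonneg_pos)
    moreover have "(\<rho> + avg_softmax 0) / t < r"
      using r t by (simp add: t_def field_simps)
    ultimately show ?thesis using 1 posdef_K by auto
  next
    case 2
    \<comment> \<open>At the threshold \<rho> equals \<open>- ?G 0\<close>, so the dual objective is
      the difference quotient of \<open>?G\<close> at 0, whose limit is the expected cost under
      \<open>Q\<^sub>0\<close>.\<close>
    have "((\<lambda>t. (?G t - ?G 0) / (t - 0)) \<longlongrightarrow> (\<integral> y. y \<bullet> (C *v y) \<partial>Q\<^sub>0)) (at 0)"
      using der0 by (simp add: has_field_derivative_iff)
    then have "((\<lambda>t. (?G t - ?G 0) / (t - 0)) \<longlongrightarrow> (\<integral> y. y \<bullet> (C *v y) \<partial>Q\<^sub>0)) (at_right 0)"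
      by (rule filterlim_at_split[THEN iffD1, THEN conjunct2])
    then have "\<forall>\<^sub>F t in at_right 0. (?G t - ?G 0) / (t - 0) < r" using r0 by (rule order_tendstoD)
    moreover have "\<forall>\<^sub>F t in at_right 0. 0 < t \<and> t < d"
      using d by (auto simp: eventually_at_right_field)
    ultimately have "\<forall>\<^sub>F t in at_right 0. 0 < t \<and> posdef (K - t *\<^sub>R C) \<and> (\<rho> + ?G t) / t < r"
      by eventually_elim (use d 2 in \<open>auto simp: add.commute\<close>)
    from eventually_happens'[OF trivial_limit_at_right_real this] show ?thesis by blast
  next
    case 3
    obtain t\<^sub>0 where t\<^sub>0: "0 < t\<^sub>0" "\<And>t. 0 \<le> t \<Longrightarrow> t < t\<^sub>0 \<Longrightarrow> posdef (K - t *\<^sub>R C)" "det (K - t\<^sub>0 *\<^sub>R C) = 0"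
      using posdef_pencil_threshold[OF posdef_K C 3(1)] by blast
    let ?h = "\<lambda>t. (\<rho> + ?G t) / t"
    have cont: "isCont ?G t" if "0 \<le> t" "t < t\<^sub>0" for t
      using differentiable_avg_softmax[OF t\<^sub>0(2)[OF that]] differentiable_imp_continuous_within by blast
    obtain t where t: "0 < t" "t < t\<^sub>0" and min: "\<And>u. 0 < u \<Longrightarrow> u < t\<^sub>0 \<Longrightarrow> ?h t \<le> ?h u"
    \<comment> \<open>At 0 the numerator has a positive limit while \<open>1 / t\<close> blows up;
      at \<open>t\<^sub>0\<close> the numerator itself blows up.\<close>
    proof (rule interior_minimum[OF t\<^sub>0(1), of ?h])
      show "continuous_on {0<..<t\<^sub>0} ?h"
        by (intro continuous_at_imp_continuous_on ballI continuous_intros cont) auto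
      have "(?G \<longlongrightarrow> avg_softmax 0) (at_right 0)"
        using cont[of 0] t\<^sub>0(1) by (auto simp: isCont_def filterlim_at_split)
      then have "((\<lambda>t. \<rho> + ?G t) \<longlongrightarrow> \<rho> + avg_softmax 0) (at_right 0)"
        by (intro tendsto_intros)
      then have "filterlim (\<lambda>t. (\<rho> + ?G t) * inverse t) at_top (at_right 0)"
        by (rule filterlim_tendsto_pos_mult_at_top[OF _ _ filterlim_inverse_at_top_right]) (use 3 in simp)
      then show "filterlim ?h at_top (at_right 0)" by (simp add: divide_inverse)
      have "filterlim (\<lambda>t. \<rho> + ?G t) at_top (at_left t\<^sub>0)"
        by (rule filterlim_tendsto_add_at_top[OF tendsto_const avg_softmax_blow_up[OF t\<^sub>0]])
      moreover have "((\<lambda>t. inverse t) \<longlongrightarrow> inverse t\<^sub>0) (at_left t\<^sub>0)"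
        using t\<^sub>0(1) by (intro tendsto_intros) auto
      ultimately have "filterlim (\<lambda>t. inverse t * (\<rho> + ?G t)) at_top (at_left t\<^sub>0)"
        using t\<^sub>0(1) by (intro filterlim_tendsto_pos_mult_at_top[of _ "inverse t\<^sub>0"]) auto
      then show "filterlim ?h at_top (at_left t\<^sub>0)" by (simp add: divide_inverse mult.commute)
    qed blast
    have pt: "posdef (K - t *\<^sub>R C)" using t t\<^sub>0(2) by simp
    obtain Q where Q: "Q \<in> amb ((\<integral> y. y \<bullet> ((t *\<^sub>R C) *v y) \<partial>Q) - ?G t)"
      using gibbs_measure_attains[OF pt] by blast
    define V where "V = (\<integral> y. y \<bullet> (C *v y) \<partial>Q)"
    have der: "(?G has_real_derivative V) (at t)"
      unfolding V_def by (rule avg_softmax_derivative[OF C pt Q])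
    have "(?h has_real_derivative (V * t - (\<rho> + ?G t)) / (t * t)) (at t)"
      using t by (auto intro!: derivative_eq_intros der)
    then have "(V * t - (\<rho> + ?G t)) / (t * t) = 0"
    proof (rule DERIV_local_min[of _ _ _ "min t (t\<^sub>0 - t)"], safe)
      fix u assume "\<bar>t - u\<bar> < min t (t\<^sub>0 - t)"
      then show "?h t \<le> ?h u" by (intro min) auto
    qed (use t in auto)
    \<comment> \<open>Stationarity says that the radius \<open>t * V - ?G t\<close> of
      \<open>Q\<close> is \<rho>, and that its expected cost \<open>V\<close> is the dual
      value.\<close>
    then have eq: "V * t = \<rho> + ?G t" using t by simp
    have "(\<integral> y. y \<bullet> ((t *\<^sub>R C) *v y) \<partial>Q) = t * V"
      by (simp add: V_def flip: scaleR_matrix_vector_assoc)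
    then have "Q \<in> amb \<rho>" using Q eq by (simp add: mult.commute)
    then have "V < r" unfolding V_def by (rule bound)
    moreover have "?h t = V" using t by (simp flip: eq)
    ultimately have "?h t < r" by simp
    then show ?thesis using t pt by blast
  qed
qed

end

section \<open>The convex program\<close>

context gaussian_sinkhorn
begin

text \<open>Both directions take \<open>X = 0\<close>, where the quadratic expectation vanishes:
  weak duality gives necessity, and the Gibbs measure of 0 gives sufficiency.\<close>

lemma feasible_iff: "amb \<rho> \<noteq> {} \<longleftrightarrow> - avg_softmax 0 \<le> \<rho>"
proof
  have K0: "posdef (K - 0)" using posdef_K by simp
  show "- avg_softmax 0 \<le> \<rho>" if ne: "amb \<rho> \<noteq> {}"
  proof -
    obtain Q where "Q \<in> amb \<rho>" using ne by blast
    from weak_duality(2)[OF this K0] show ?thesis by simp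
  qed
  show "amb \<rho> \<noteq> {}" if "- avg_softmax 0 \<le> \<rho>"
    using gibbs_measure_attains[OF K0] amb_mono that by fastforce
qed

lemma avg_softmax_zero:
  "- avg_softmax 0 = \<epsilon> / 2 * ln (det (\<Sigma> + (\<epsilon> / 2) *\<^sub>R mat 1)) - \<epsilon> * CARD('k) / 2 * ln (\<epsilon> / 2)
     + \<epsilon> / 2 * (m \<bullet> (matrix_inv \<Sigma> *v m))
     + 1 / real n * (\<Sum>i=1..n. (norm (w i))\<^sup>2 - shift (w i) \<bullet> (matrix_inv K *v shift (w i)))"
proof -
  define a where "a = \<epsilon> / 2 * ln (det (\<Sigma> + (\<epsilon> / 2) *\<^sub>R mat 1)) - \<epsilon> * CARD('k) / 2 * ln (\<epsilon> / 2)
     + \<epsilon> / 2 * (m \<bullet> (matrix_inv \<Sigma> *v m))"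
  have "ln (det (\<Sigma> + (\<epsilon> / 2) *\<^sub>R mat 1)) = ln (det K) + ln (det \<Sigma>)"
    using posdef_det_pos[OF posdef_K] posdef_det_pos[OF posdef_cov] by (simp add: ln_mult flip: det_K)
  then have "- softmax 0 x = a + ((norm x)\<^sup>2 - shift x \<bullet> (matrix_inv K *v shift x))" for x
    by (simp add: softmax_def a_def power2_norm_eq_inner algebra_simps)
  then have "- avg_softmax 0 = 1 / real n * (\<Sum>i=1..n. a + ((norm (w i))\<^sup>2 - shift (w i) \<bullet> (matrix_inv K *v shift (w i))))"
    by (simp only: avg_softmax_def sum_negf[symmetric] mult_minus_right[symmetric])
  also have "\<dots> = a + 1 / real n * (\<Sum>i=1..n. (norm (w i))\<^sup>2 - shift (w i) \<bullet> (matrix_inv K *v shift (w i)))"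
    unfolding sum.distrib using n_pos by (simp add: distrib_left)
  finally show ?thesis by (simp add: a_def)
qed

text \<open>The program works with matrices scaled by the multiplier. The dimension times
  \<open>ln l\<close> arises both from \<open>ln (l * \<epsilon> / 2)\<close> and from the
  log-determinant of the scaled matrix, and cancels.\<close>

lemma softmax_perspective:
  assumes l: "0 < l" and M: "posdef (l *\<^sub>R K - Q)"
  shows "posdef (K - (1 / l) *\<^sub>R Q)"
    and "l * softmax ((1 / l) *\<^sub>R Q) x = l * \<epsilon> * CARD('k) / 2 * ln (l * \<epsilon> / 2) - l * \<epsilon> / 2 * ln (det \<Sigma>)
       - l * \<epsilon> / 2 * ln (det (l *\<^sub>R K - Q)) + (l *\<^sub>R shift x) \<bullet> (matrix_inv (l *\<^sub>R K - Q) *v (l *\<^sub>R shift x))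
       - l * (x \<bullet> x) - l * \<epsilon> / 2 * (m \<bullet> (matrix_inv \<Sigma> *v m))"
proof -
  define N where "N = K - (1 / l) *\<^sub>R Q"
  have "N = (1 / l) *\<^sub>R (l *\<^sub>R K - Q)" using l by (simp add: N_def scaleR_diff_right)
  then have N: "posdef N" using posdef_scaleR[OF M, of "1 / l"] l by simp
  then show "posdef (K - (1 / l) *\<^sub>R Q)" by (simp only: N_def)
  have eq: "l *\<^sub>R K - Q = l *\<^sub>R N" using l by (simp add: N_def scaleR_diff_right)
  have d: "0 < det N" by (rule posdef_det_pos[OF N])
  have logdet: "ln (det (l *\<^sub>R N)) = CARD('k) * ln l + ln (det N)"
    using l d by (simp add: det_scaleR ln_mult ln_realpow)
  have log: "ln (l * \<epsilon> / 2) = ln l + ln (\<epsilon> / 2)"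
    using l eps_pos ln_mult[of l "\<epsilon> / 2"] by simp
  have quad: "(l *\<^sub>R shift x) \<bullet> (matrix_inv (l *\<^sub>R N) *v (l *\<^sub>R shift x))
      = l * (shift x \<bullet> (matrix_inv N *v shift x))"
    using l by (simp add: matrix_inv_scaleR[OF N] matrix_vector_mult_scaleR flip: scaleR_matrix_vector_assoc)
  show "l * softmax ((1 / l) *\<^sub>R Q) x = l * \<epsilon> * CARD('k) / 2 * ln (l * \<epsilon> / 2) - l * \<epsilon> / 2 * ln (det \<Sigma>)
       - l * \<epsilon> / 2 * ln (det (l *\<^sub>R K - Q)) + (l *\<^sub>R shift x) \<bullet> (matrix_inv (l *\<^sub>R K - Q) *v (l *\<^sub>R shift x))
       - l * (x \<bullet> x) - l * \<epsilon> / 2 * (m \<bullet> (matrix_inv \<Sigma> *v m))"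
    unfolding eq softmax_def N_def[symmetric] logdet log quad by (simp add: field_simps)
qed

section \<open>The program constraints and their duality with the worst-case cost\<close>

lemma cost_matrix:
  fixes D :: "real^'q^'q" and \<Phi> :: "real^'k^'q"
  assumes "psd D"
  shows "transpose (psd_sqrt D ** \<Phi>) ** (psd_sqrt D ** \<Phi>) = transpose \<Phi> ** D ** \<Phi>"
    and "psd (transpose \<Phi> ** D ** \<Phi>)"
proof -
  have R: "transpose (psd_sqrt D) = psd_sqrt D" "psd_sqrt D ** psd_sqrt D = D"
    using psd_sqrt[OF assms] by (auto simp: psd_def)
  show "transpose (psd_sqrt D ** \<Phi>) ** (psd_sqrt D ** \<Phi>) = transpose \<Phi> ** D ** \<Phi>"
    by (metis R matrix_mul_assoc matrix_transpose_mul)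
  have "transpose D = D" using assms by (simp add: psd_def)
  then have "transpose (transpose \<Phi> ** D ** \<Phi>) = transpose \<Phi> ** D ** \<Phi>"
    by (simp add: matrix_transpose_mul matrix_mul_assoc)
  moreover have "x \<bullet> ((transpose \<Phi> ** D ** \<Phi>) *v x) = (\<Phi> *v x) \<bullet> (D *v (\<Phi> *v x))" for x
    by (simp only: matrix_vector_mul_assoc[symmetric] inner_transpose[of x "transpose \<Phi>"] transpose_transpose)
  ultimately show "psd (transpose \<Phi> ** D ** \<Phi>)" using assms by (simp add: psd_def)
qed

lemma program_constraints_iff:
  fixes D :: "real^'q^'q" and \<Phi> :: "real^'k^'q"
  assumes D: "psd D"
  shows "program_constraints \<epsilon> m \<Sigma> n w D l Q \<sigma> \<zeta> \<Phi> \<longleftrightarrow>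
    0 < l \<and> psd Q \<and> posdef (l *\<^sub>R K - Q) \<and>
    (\<forall>i\<in>{1..n}. l * \<epsilon> * CARD('k) / 2 * ln (l * \<epsilon> / 2) - l * \<epsilon> / 2 * ln (det \<Sigma>)
        - l * \<epsilon> / 2 * ln (det (l *\<^sub>R K - Q)) + \<zeta> i \<le> \<sigma> i) \<and>
    (\<forall>i\<in>{1..n}. (l *\<^sub>R shift (w i)) \<bullet> (matrix_inv (l *\<^sub>R K - Q) *v (l *\<^sub>R shift (w i)))
        \<le> \<zeta> i + l * (norm (w i))\<^sup>2 + l * \<epsilon> / 2 * (m \<bullet> (matrix_inv \<Sigma> *v m))) \<and>
    (\<forall>x. x \<bullet> ((transpose \<Phi> ** D ** \<Phi>) *v x) \<le> x \<bullet> (Q *v x))"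
proof -
  \<comment> \<open>A zero multiplier would make \<open>- Q\<close> positive definite; the vector of
    ones is a test vector that excludes this.\<close>
  have pos: "0 \<le> l \<longleftrightarrow> 0 < l" if "psd Q" "posdef (l *\<^sub>R K - Q)"
  proof -
    have "(1 :: real^'k) \<noteq> 0" by simp
    then have "0 < 1 \<bullet> ((l *\<^sub>R K - Q) *v 1)" using that(2) unfolding posdef_def by blast
    also have "1 \<bullet> ((l *\<^sub>R K - Q) *v 1) = l * (1 \<bullet> (K *v 1)) - 1 \<bullet> (Q *v 1)"
      by (simp add: matrix_vector_mult_diff_rdistrib inner_diff_right flip: scaleR_matrix_vector_assoc)
    finally have "0 < l * (1 \<bullet> (K *v 1)) - 1 \<bullet> (Q *v 1)" .
    moreover have "0 \<le> 1 \<bullet> (Q *v 1)" using that(1) by (simp add: psd_def)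
    ultimately have "l \<noteq> 0" by auto
    then show ?thesis by auto
  qed
  have shift: "l *\<^sub>R w i + (l * \<epsilon> / 2) *\<^sub>R (matrix_inv \<Sigma> *v m) = l *\<^sub>R shift (w i)" for i
    by (simp add: shift_def scaleR_add_right)
  show ?thesis
  \<comment> \<open>The Schur complement lemmas presuppose these two conditions; if one fails, both
    sides are false.\<close>
  proof (cases "psd Q \<and> posdef (l *\<^sub>R K - Q)")
    case True
    then have "transpose Q = Q" by (simp add: psd_def)
    note schur = psd_schur_identity[OF this, of "psd_sqrt D ** \<Phi>", unfolded cost_matrix(1)[OF D]]
      psd_schur_scalar[OF True[THEN conjunct2]]
    show ?thesis
      unfolding program_constraints_def Let_def K_def[symmetric] shift schur
      using True pos by blast
  next
    case False
    then show ?thesis unfolding program_constraints_def Let_def K_def[symmetric] by blast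
  qed
qed

text \<open>Eliminating \<zeta> leaves
  \<open>l * softmax ((1 / l) *\<^sub>R Q) (w i) \<le> \<sigma> i\<close>. Weak duality at
  \<open>(1 / l) *\<^sub>R Q\<close>, multiplied by \<open>l\<close>, bounds the expectation of the
  form of \<open>Q\<close>, which dominates the cost.\<close>

lemma program_weak_duality:
  fixes D :: "real^'q^'q" and \<Phi> :: "real^'k^'q"
  assumes D: "psd D" and prog: "program_constraints \<epsilon> m \<Sigma> n w D l Q \<sigma> \<zeta> \<Phi>"
  shows "worst_case_cost (amb \<rho>) D \<Phi> \<le> ereal (l * \<rho> + 1 / real n * (\<Sum>i=1..n. \<sigma> i))"
  unfolding worst_case_cost_def
proof (rule SUP_least)
  let ?C = "transpose \<Phi> ** D ** \<Phi>"
  have l: "0 < l" and M: "posdef (l *\<^sub>R K - Q)"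
    and CQ: "\<And>x. x \<bullet> (?C *v x) \<le> x \<bullet> (Q *v x)"
    and con: "\<And>i. i \<in> {1..n} \<Longrightarrow> l * \<epsilon> * CARD('k) / 2 * ln (l * \<epsilon> / 2) - l * \<epsilon> / 2 * ln (det \<Sigma>)
        - l * \<epsilon> / 2 * ln (det (l *\<^sub>R K - Q)) + \<zeta> i \<le> \<sigma> i"
      "\<And>i. i \<in> {1..n} \<Longrightarrow> (l *\<^sub>R shift (w i)) \<bullet> (matrix_inv (l *\<^sub>R K - Q) *v (l *\<^sub>R shift (w i)))
        \<le> \<zeta> i + l * (norm (w i))\<^sup>2 + l * \<epsilon> / 2 * (m \<bullet> (matrix_inv \<Sigma> *v m))"
    using prog unfolding program_constraints_iff[OF D] by auto
  note X = softmax_perspective[OF l M]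
  have "l * softmax ((1 / l) *\<^sub>R Q) (w i) \<le> \<sigma> i" if "i \<in> {1..n}" for i
    using con(1)[OF that] con(2)[OF that] unfolding X(2) power2_norm_eq_inner by linarith
  then have avg: "l * avg_softmax ((1 / l) *\<^sub>R Q) \<le> 1 / real n * (\<Sum>i=1..n. \<sigma> i)"
    unfolding avg_softmax_def mult.left_commute[of l] sum_distrib_left
    by (intro sum_mono mult_left_mono) auto
  fix P' assume P': "P' \<in> amb \<rho>"
  have int: "integrable P' (\<lambda>y. y \<bullet> (((1 / l) *\<^sub>R Q) *v y))"
    and le: "(\<integral> y. y \<bullet> (((1 / l) *\<^sub>R Q) *v y) \<partial>P') \<le> \<rho> + avg_softmax ((1 / l) *\<^sub>R Q)"
    using weak_duality[OF P' X(1)] by auto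
  have [measurable_cong]: "sets P' = sets borel" using P' by (simp add: sinkhorn_ball_def)
  have intQ: "integrable P' (\<lambda>y. y \<bullet> (Q *v y))"
    using integrable_mult_right[OF int, of l] l by (simp flip: scaleR_matrix_vector_assoc)
  have leQ: "(\<integral> y. y \<bullet> (Q *v y) \<partial>P') \<le> l * (\<rho> + avg_softmax ((1 / l) *\<^sub>R Q))"
    using le l by (simp add: field_simps flip: scaleR_matrix_vector_assoc)
  have Cpos: "0 \<le> x \<bullet> (?C *v x)" for x using cost_matrix(2)[OF D, of \<Phi>] by (simp add: psd_def)
  have "(\<integral>\<^sup>+ y. ennreal (y \<bullet> (?C *v y)) \<partial>P') \<le> (\<integral>\<^sup>+ y. ennreal (y \<bullet> (Q *v y)) \<partial>P')"
    by (intro nn_integral_mono ennreal_leI CQ)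
  also have "\<dots> = ennreal (\<integral> y. y \<bullet> (Q *v y) \<partial>P')"
    using Cpos CQ by (intro nn_integral_eq_integral intQ AE_I2) (meson order_trans)
  finally have "enn2ereal (\<integral>\<^sup>+ y. ennreal (y \<bullet> (?C *v y)) \<partial>P') \<le> enn2ereal (ennreal (\<integral> y. y \<bullet> (Q *v y) \<partial>P'))"
    by (simp add: less_eq_ennreal.rep_eq)
  also have "\<dots> = ereal (\<integral> y. y \<bullet> (Q *v y) \<partial>P')"
    by (intro enn2ereal_ennreal Bochner_Integration.integral_nonneg) (meson Cpos CQ order_trans)
  also have "\<dots> \<le> ereal (l * \<rho> + 1 / real n * (\<Sum>i=1..n. \<sigma> i))"
    using leQ avg by (simp add: distrib_left)
  finally show "enn2ereal (\<integral>\<^sup>+ y. ennreal (y \<bullet> (?C *v y)) \<partial>P') \<le> ereal (l * \<rho> + 1 / real n * (\<Sum>i=1..n. \<sigma> i))" .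
qed

text \<open>A dual point \<open>t\<close> becomes a program point with \<open>l = 1 / t\<close>,
  \<open>Q\<close> the cost matrix itself, and \<zeta> and \<sigma> chosen so that their constraints
  hold with equality.\<close>

lemma program_strong_duality:
  fixes D :: "real^'q^'q" and \<Phi> :: "real^'k^'q"
  assumes D: "psd D" and ne: "amb \<rho> \<noteq> {}" and less: "worst_case_cost (amb \<rho>) D \<Phi> < ereal r"
  shows "\<exists>l Q \<sigma> \<zeta>. program_constraints \<epsilon> m \<Sigma> n w D l Q \<sigma> \<zeta> \<Phi> \<and> l * \<rho> + 1 / real n * (\<Sum>i=1..n. \<sigma> i) < r"
proof -
  define C where "C = transpose \<Phi> ** D ** \<Phi>"
  have C: "psd C" unfolding C_def by (rule cost_matrix(2)[OF D])
  have "(\<integral> y. y \<bullet> (C *v y) \<partial>P') < r" if P': "P' \<in> amb \<rho>" for P'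
  proof -
    have [measurable_cong]: "sets P' = sets borel" using P' by (simp add: sinkhorn_ball_def)
    let ?I = "\<integral>\<^sup>+ y. ennreal (y \<bullet> (C *v y)) \<partial>P'"
    have "enn2ereal ?I \<le> worst_case_cost (amb \<rho>) D \<Phi>"
      unfolding worst_case_cost_def C_def by (rule SUP_upper[OF P'])
    then have I: "enn2ereal ?I < ereal r" using less by (rule le_less_trans)
    have "(\<integral> y. y \<bullet> (C *v y) \<partial>P') = enn2real ?I"
      by (rule integral_eq_nn_integral) (use C in \<open>auto simp: psd_def\<close>)
    \<comment> \<open>The bound excludes an infinite integral, for which \<open>enn2real\<close>
      would return 0.\<close>
    also have "ereal (enn2real ?I) < ereal r"
      using I by (cases ?I) (auto simp: enn2ereal_ennreal)
    finally show ?thesis by simp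
  qed
  then obtain t where t: "0 < t" "posdef (K - t *\<^sub>R C)" "(\<rho> + avg_softmax (t *\<^sub>R C)) / t < r"
    using strong_duality[OF C] ne[unfolded feasible_iff] by blast
  define l where "l = 1 / t"
  have l: "0 < l" "t = 1 / l" using t by (auto simp: l_def)
  have "l *\<^sub>R K - C = l *\<^sub>R (K - t *\<^sub>R C)" using t by (simp add: l_def scaleR_diff_right)
  then have M: "posdef (l *\<^sub>R K - C)" using posdef_scaleR[OF t(2) l(1)] by simp
  define \<zeta> where "\<zeta> i = (l *\<^sub>R shift (w i)) \<bullet> (matrix_inv (l *\<^sub>R K - C) *v (l *\<^sub>R shift (w i)))
    - l * (w i \<bullet> w i) - l * \<epsilon> / 2 * (m \<bullet> (matrix_inv \<Sigma> *v m))" for i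
  define \<sigma> where "\<sigma> i = l * softmax (t *\<^sub>R C) (w i)" for i
  have \<sigma>: "\<sigma> i = l * \<epsilon> * CARD('k) / 2 * ln (l * \<epsilon> / 2) - l * \<epsilon> / 2 * ln (det \<Sigma>)
       - l * \<epsilon> / 2 * ln (det (l *\<^sub>R K - C)) + \<zeta> i" for i
    unfolding \<sigma>_def l(2) softmax_perspective(2)[OF l(1) M] \<zeta>_def by simp
  have "program_constraints \<epsilon> m \<Sigma> n w D l C \<sigma> \<zeta> \<Phi>"
    unfolding program_constraints_iff[OF D] using l M C
    by (auto simp: \<sigma> \<zeta>_def C_def power2_norm_eq_inner)
  moreover have "l * \<rho> + 1 / real n * (\<Sum>i=1..n. \<sigma> i) < r"
    using t by (simp add: \<sigma>_def l_def avg_softmax_def field_simps flip: sum_distrib_left sum_divide_distrib)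
  ultimately show ?thesis by blast
qed

text \<open>Weak duality puts the cost of a better map strictly below the optimal program value, and
  strong duality for that map then yields a feasible point of smaller value. The strict gap makes an
  attained program optimum for the competing map dispensable.\<close>

lemma program_minimizer:
  fixes D :: "real^'q^'q" and \<Phi> :: "real^'k^'q"
  assumes D: "psd D"
    and min: "is_arg_min (\<lambda>(l, Q, \<sigma>, \<zeta>, \<Phi>). l * \<rho> + 1 / real n * (\<Sum>i=1..n. \<sigma> i))
         (\<lambda>(l, Q, \<sigma>, \<zeta>, \<Phi>). ach \<Phi> \<and> program_constraints \<epsilon> m \<Sigma> n w D l Q \<sigma> \<zeta> \<Phi>)
         (l, Q, \<sigma>, \<zeta>, \<Phi>)"
  shows "is_arg_min (worst_case_cost (amb \<rho>) D) ach \<Phi>"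
  unfolding is_arg_min_def
proof (intro conjI notI)
  let ?v = "l * \<rho> + 1 / real n * (\<Sum>i=1..n. \<sigma> i)"
  have feas: "ach \<Phi>" "program_constraints \<epsilon> m \<Sigma> n w D l Q \<sigma> \<zeta> \<Phi>"
    and opt: "\<And>l' Q' \<sigma>' \<zeta>' \<Phi>'. ach \<Phi>' \<Longrightarrow> program_constraints \<epsilon> m \<Sigma> n w D l' Q' \<sigma>' \<zeta>' \<Phi>' \<Longrightarrow>
      \<not> l' * \<rho> + 1 / real n * (\<Sum>i=1..n. \<sigma>' i) < ?v"
  proof -
    have "(ach \<Phi> \<and> program_constraints \<epsilon> m \<Sigma> n w D l Q \<sigma> \<zeta> \<Phi>) \<and>
        \<not> (\<exists>l' Q' \<sigma>' \<zeta>' \<Phi>'. (ach \<Phi>' \<and> program_constraints \<epsilon> m \<Sigma> n w D l' Q' \<sigma>' \<zeta>' \<Phi>') \<and>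
          l' * \<rho> + 1 / real n * (\<Sum>i=1..n. \<sigma>' i) < ?v)"
      using min unfolding is_arg_min_def split_paired_Ex prod.case .
    then show "ach \<Phi>" "program_constraints \<epsilon> m \<Sigma> n w D l Q \<sigma> \<zeta> \<Phi>"
      "\<And>l' Q' \<sigma>' \<zeta>' \<Phi>'. ach \<Phi>' \<Longrightarrow> program_constraints \<epsilon> m \<Sigma> n w D l' Q' \<sigma>' \<zeta>' \<Phi>' \<Longrightarrow>
        \<not> l' * \<rho> + 1 / real n * (\<Sum>i=1..n. \<sigma>' i) < ?v"
      by blast+
  qed
  show "ach \<Phi>" by fact
  assume "\<exists>\<Phi>'. ach \<Phi>' \<and> worst_case_cost (amb \<rho>) D \<Phi>' < worst_case_cost (amb \<rho>) D \<Phi>"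
  then obtain \<Phi>' where \<Phi>': "ach \<Phi>'" "worst_case_cost (amb \<rho>) D \<Phi>' < worst_case_cost (amb \<rho>) D \<Phi>" by blast
  \<comment> \<open>Over an empty ambiguity set every map costs \<open>- \<infinity>\<close>, so a
    strict improvement forces feasibility.\<close>
  then have "amb \<rho> \<noteq> {}" by (auto simp: worst_case_cost_def)
  moreover have "worst_case_cost (amb \<rho>) D \<Phi>' < ereal ?v"
    using \<Phi>'(2) program_weak_duality[OF D feas(2)] by (rule less_le_trans)
  ultimately show False using program_strong_duality[OF D] opt[OF \<Phi>'(1)] by blast
qed

end

theorem theorem1:
  fixes A :: "nat \<Rightarrow> real^'d::finite^'d"
    and B :: "nat \<Rightarrow> real^'m::finite^'d"
    and E :: "nat \<Rightarrow> real^'p::finite^'d"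
    and D :: "real^('N::{finite,linorder} \<times> 'd + 'N \<times> 'm)^('N \<times> 'd + 'N \<times> 'm)"
    and what :: "nat \<Rightarrow> real^('d, 'p, 'N) noise_idx"
    and m :: "real^('d, 'p, 'N) noise_idx"
    and \<Sigma> :: "real^('d, 'p, 'N) noise_idx^('d, 'p, 'N) noise_idx"
    and \<B> :: "(real^('d, 'p, 'N) noise_idx) measure set"
    and n s :: nat and \<rho> \<epsilon> :: real
  assumes "s = CARD('d) + (CARD('N) - 1) * CARD('p)"
    and "1 \<le> n" and "psd D" and "0 \<le> \<rho>" and "0 < \<epsilon>" and "posdef \<Sigma>"
    and "\<B> = sinkhorn_ball sq_dist \<epsilon> (gaussian m \<Sigma>) \<rho> (empirical n what)"
  shows
    "(\<B> \<noteq> {} \<longleftrightarrow>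
       \<rho> \<ge> \<epsilon> / 2 * ln (det (\<Sigma> + (\<epsilon> / 2) *\<^sub>R mat 1)) - \<epsilon> * real s / 2 * ln (\<epsilon> / 2)
           + \<epsilon> / 2 * (m \<bullet> (matrix_inv \<Sigma> *v m))
           + 1 / real n * (\<Sum>i=1..n. (norm (what i))\<^sup>2
               - (what i + (\<epsilon> / 2) *\<^sub>R (matrix_inv \<Sigma> *v m)) \<bullet>
                 (matrix_inv (mat 1 + (\<epsilon> / 2) *\<^sub>R matrix_inv \<Sigma>) *v
                  (what i + (\<epsilon> / 2) *\<^sub>R (matrix_inv \<Sigma> *v m))))) \<and>
     (\<forall>l Q \<sigma> \<zeta> \<Phi>.
       is_arg_min (\<lambda>(l, Q, \<sigma>, \<zeta>, \<Phi>). l * \<rho> + 1 / real n * (\<Sum>i=1..n. \<sigma> i))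
         (\<lambda>(l, Q, \<sigma>, \<zeta>, \<Phi>). achievable A B E \<Phi> \<and> program_constraints \<epsilon> m \<Sigma> n what D l Q \<sigma> \<zeta> \<Phi>)
         (l, Q, \<sigma>, \<zeta>, \<Phi>)
       \<longrightarrow> is_arg_min (worst_case_cost \<B> D) (achievable A B E) \<Phi>)"
proof -
  interpret gaussian_sinkhorn m \<Sigma> \<epsilon> n what
    using assms by unfold_locales auto
  have s: "real s = real CARD(('d, 'p, 'N) noise_idx)"
    using assms(1) by (simp only: card_noise_idx)
  have thr: "- avg_softmax 0 = \<epsilon> / 2 * ln (det (\<Sigma> + (\<epsilon> / 2) *\<^sub>R mat 1)) - \<epsilon> * real s / 2 * ln (\<epsilon> / 2)
           + \<epsilon> / 2 * (m \<bullet> (matrix_inv \<Sigma> *v m))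
           + 1 / real n * (\<Sum>i=1..n. (norm (what i))\<^sup>2
               - (what i + (\<epsilon> / 2) *\<^sub>R (matrix_inv \<Sigma> *v m)) \<bullet>
                 (matrix_inv (mat 1 + (\<epsilon> / 2) *\<^sub>R matrix_inv \<Sigma>) *v
                  (what i + (\<epsilon> / 2) *\<^sub>R (matrix_inv \<Sigma> *v m))))"
    unfolding s avg_softmax_zero shift_def K_def by simp
  show ?thesis
    unfolding assms(7)
  proof (intro conjI allI impI)
    show "amb \<rho> \<noteq> {} \<longleftrightarrow> \<rho> \<ge> \<epsilon> / 2 * ln (det (\<Sigma> + (\<epsilon> / 2) *\<^sub>R mat 1)) - \<epsilon> * real s / 2 * ln (\<epsilon> / 2)
           + \<epsilon> / 2 * (m \<bullet> (matrix_inv \<Sigma> *v m))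
           + 1 / real n * (\<Sum>i=1..n. (norm (what i))\<^sup>2
               - (what i + (\<epsilon> / 2) *\<^sub>R (matrix_inv \<Sigma> *v m)) \<bullet>
                 (matrix_inv (mat 1 + (\<epsilon> / 2) *\<^sub>R matrix_inv \<Sigma>) *v
                  (what i + (\<epsilon> / 2) *\<^sub>R (matrix_inv \<Sigma> *v m))))"
      unfolding thr[symmetric] by (rule feasible_iff)
  qed (rule program_minimizer[OF assms(3)])
qed

end
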